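(* Let $p$ be an odd prime, $e\ge 1$, $q=p^{2e}$, and let $m$ be a positive integer with $m+2\le q-1$. Let $JW_m^2(q)$ be the bipartite graph whose vertex set is the disjoint union of a point set $\mathfrak{P}=\mathbb{F}_q^{m+1}$ and a line set $\mathfrak{L}=\mathbb{F}_q^{m+1}$, in which a point $(p_1,\dots,p_{m+1})$ is adjacent to a line $[l_1,\dots,l_{m+1}]$ if and only if $$l_k+p_k=p_1^{k-1}l_1\ \ (2\le k\le m),\qquad l_{m+1}+p_{m+1}=p_1^{m+2}l_1 .$$ Then: 1) $\pm q,\ \pm\sqrt{(m-1)q},\ \pm\sqrt{(m-2)q},\ \dots,\ \pm\sqrt{2q},\ \pm\sqrt{q},\ 0$ are distinct eigenvalues (of the adjacency matrix) of $JW_m^2(q)$, and for $0\le i\le m-1$ the multiplicity of the eigenvalue $\pm\sqrt{iq}$ is $$(q-1)\binom{q}{i}\sum_{d=i}^{m-1}\sum_{k=0}^{d-i}(-1)^k\binom{q-i}{k}q^{d-i-k}+(q-1)N_i(x^{m+2},m-1).$$ 2) For $m\le i\le m+2$, $\pm\sqrt{iq}$ are eigenvalues of $JW_m^2(q)$ if and only if $N_i(x^{m+2},m-1)>0$; furthermore, the multiplicity of the eigenvalue $\pm\sqrt{iq}$ is $(q-1)N_i(x^{m+2},m-1)$.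
   Context: For integers $0\le \ell<n$ and a monic polynomial $u(x)=x^n+u_{n-1}x^{n-1}+\cdots+u_{\ell+1}x^{\ell+1}\in\mathbb{F}_q[x]$, $N_k(u(x),\ell)$ denotes the number of polynomials $v(x)=a_\ell x^\ell+\cdots+a_0\in\mathbb{F}_q[x]$ such that $u(x)+v(x)$ has exactly $k$ distinct roots in $\mathbb{F}_q$. Thus $N_i(x^{m+2},m-1)$ counts monic polynomials $x^{m+2}+a_{m-1}x^{m-1}+\cdots+a_0$ over $\mathbb{F}_q$ with exactly $i$ distinct roots in $\mathbb{F}_q$.
   Formalization: For i=0 the multiplicity of the eigenvalue 0 is proved to be twice the stated formula, since +0 and -0 coincide; the formula as stated fails there (q=9, m=1: it gives 8, but the multiplicity of 0 is 16). *)

theory Defs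
  imports
    "HOL-Library.FuncSet"
    "HOL-Computational_Algebra.Polynomial"
    "Jordan_Normal_Form.Char_Poly"
begin

text \<open>
  The adjacency matrix of a finite graph depends on an enumeration of the vertices; it is taken with
  respect to a duplicate-free list \<open>vs\<close> of them.
\<close>

definition adjacency_matrix :: "('v \<Rightarrow> 'v \<Rightarrow> bool) \<Rightarrow> 'v list \<Rightarrow> real mat" where
  "adjacency_matrix adj vs =
     mat (length vs) (length vs) (\<lambda>(i, j). if adj (vs ! i) (vs ! j) then 1 else 0)"

text \<open>
  Vectors of length \<open>m + 1\<close> over the field are extensional functions on \<open>{1..m+1}\<close>, so
  that coordinates are numbered from 1. \<open>Inl\<close> marks points and \<open>Inr\<close> marks lines.
\<close>

definition jw_vertices :: "nat \<Rightarrow> ((nat \<Rightarrow> 'a) + (nat \<Rightarrow> 'a)) set" where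
  "jw_vertices m = ({1..m+1} \<rightarrow>\<^sub>E UNIV) <+> ({1..m+1} \<rightarrow>\<^sub>E UNIV)"

definition jw_incident :: "nat \<Rightarrow> (nat \<Rightarrow> 'a::field) \<Rightarrow> (nat \<Rightarrow> 'a) \<Rightarrow> bool" where
  "jw_incident m p l \<longleftrightarrow>
     (\<forall>k\<in>{2..m}. l k + p k = p 1 ^ (k - 1) * l 1) \<and>
     l (m + 1) + p (m + 1) = p 1 ^ (m + 2) * l 1"

fun jw_adj :: "nat \<Rightarrow> (nat \<Rightarrow> 'a::field) + (nat \<Rightarrow> 'a) \<Rightarrow> (nat \<Rightarrow> 'a) + (nat \<Rightarrow> 'a) \<Rightarrow> bool" where
  "jw_adj m (Inl p) (Inr l) = jw_incident m p l"
| "jw_adj m (Inr l) (Inl p) = jw_incident m p l"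
| "jw_adj m (Inl _) (Inl _) = False"
| "jw_adj m (Inr _) (Inr _) = False"

text \<open>
  \<open>num_root_polys k u l\<close> is \<open>N\<^sub>k(u(x), l)\<close>. Since \<open>degree 0 = 0\<close>, the
  condition \<open>degree v \<le> l\<close> includes the zero polynomial \<open>v\<close>.
\<close>

definition num_root_polys :: "nat \<Rightarrow> 'a::{field,finite} poly \<Rightarrow> nat \<Rightarrow> nat" where
  "num_root_polys k u l = card {v. degree v \<le> l \<and> card {x. poly (u + v) x = 0} = k}"

text \<open>
  The multiplicity of an eigenvalue \<open>r\<close> of \<open>A\<close> is \<open>order r (char_poly A)\<close>.
  In a spectrum written as pairs \<open>\<plusminus>sqrt (i * q)\<close>, each sign contributes the stated
  multiplicity. For \<open>i = 0\<close> the two signs name the same eigenvalue 0, whose multiplicity is therefore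
  twice the stated number.
\<close>

end

theory Submission
  imports Defs
begin

text \<open>
  Listing the lines first turns the adjacency matrix into \<open>[[0, B\<^sup>T], [B, 0]]\<close>, so its
  characteristic polynomial is that of \<open>B\<^sup>T B\<close> at \<open>X\<^sup>2\<close>. The entry of \<open>B\<^sup>T B\<close> at two lines
  depends only on their difference, hence the additive characters \<open>l \<mapsto> \<chi> (c \<bullet> l)\<close> of
  \<open>F\<^sub>q\<^sup>m\<^sup>+\<^sup>1\<close> diagonalize it. Summing the character over the \<open>q\<close> lines through each of the \<open>q\<close>
  points of a line shows that its eigenvalue is \<open>q\<close> times the number of roots of
  \<open>f\<^sub>c = c\<^sub>1 + c\<^sub>2 x + \<dots> + c\<^sub>m x\<^sup>m\<^sup>-\<^sup>1 + c\<^sub>m\<^sub>+\<^sub>1 x\<^sup>m\<^sup>+\<^sup>2\<close>. The \<open>f\<^sub>c\<close> with \<open>c\<^sub>m\<^sub>+\<^sub>1 \<noteq> 0\<close> are counted, after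
  scaling, by \<open>N\<^sub>i\<close>; those with \<open>c\<^sub>m\<^sub>+\<^sub>1 = 0\<close> by inclusion-exclusion over the root set.
\<close>

section \<open>Characteristic polynomials of matrices indexed by lists\<close>

text \<open>Addressing entries by list elements instead of positions turns products along a
  duplicate-free list into sums over its set, so character sums can be used directly as matrix
  identities.\<close>

definition list_mat :: "('b \<Rightarrow> 'c \<Rightarrow> 'r) \<Rightarrow> 'b list \<Rightarrow> 'c list \<Rightarrow> 'r mat" where
  "list_mat f xs ys = mat (length xs) (length ys) (\<lambda>(i, j). f (xs ! i) (ys ! j))"

lemma list_mat_carrier [simp]: "list_mat f xs ys \<in> carrier_mat (length xs) (length ys)"
  by (simp add: list_mat_def)

lemma dim_list_mat [simp]:
  "dim_row (list_mat f xs ys) = length xs" "dim_col (list_mat f xs ys) = length ys"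
  by (simp_all add: list_mat_def)

lemma index_list_mat [simp]:
  "i < length xs \<Longrightarrow> j < length ys \<Longrightarrow> list_mat f xs ys $$ (i, j) = f (xs ! i) (ys ! j)"
  by (simp add: list_mat_def)

lemma list_mat_cong:
  assumes "\<And>x y. x \<in> set xs \<Longrightarrow> y \<in> set ys \<Longrightarrow> f x y = g x y"
  shows "list_mat f xs ys = list_mat g xs ys"
  by (rule eq_matI) (auto simp: assms)

lemma sum_nth_eq_sum_set:
  "distinct xs \<Longrightarrow> (\<Sum>i<length xs. f (xs ! i)) = (\<Sum>x\<in>set xs. f x)"
  by (rule sum.reindex_bij_betw) (rule bij_betw_nth, auto)

lemma list_mat_mult:
  assumes "distinct ys"
  shows "list_mat f xs ys * list_mat g ys zs =
    list_mat (\<lambda>x z. \<Sum>y\<in>set ys. f x y * (g y z :: 'r :: comm_semiring_0)) xs zs"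
proof (rule eq_matI)
  fix i j
  assume "i < dim_row (list_mat (\<lambda>x z. \<Sum>y\<in>set ys. f x y * g y z) xs zs)"
    and "j < dim_col (list_mat (\<lambda>x z. \<Sum>y\<in>set ys. f x y * g y z) xs zs)"
  then have "i < length xs" "j < length zs" by auto
  then show "(list_mat f xs ys * list_mat g ys zs) $$ (i, j) =
      list_mat (\<lambda>x z. \<Sum>y\<in>set ys. f x y * g y z) xs zs $$ (i, j)"
    using sum_nth_eq_sum_set[OF assms, of "\<lambda>y. f (xs ! i) y * g y (zs ! j)"]
    by (simp add: scalar_prod_def lessThan_atLeast0)
qed auto

lemma list_mat_one:
  assumes "distinct xs"
  shows "list_mat (\<lambda>x y. if x = y then 1 else 0) xs xs = 1\<^sub>m (length xs)"
  by (rule eq_matI) (auto simp: nth_eq_iff_index_eq assms)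

lemma char_poly_list_mat_diag:
  fixes d :: "'b \<Rightarrow> 'r :: comm_ring_1"
  assumes "distinct xs"
  shows "char_poly (list_mat (\<lambda>x y. if x = y then d x else 0) xs xs) =
    (\<Prod>x\<in>set xs. [:- d x, 1:])"
proof -
  let ?D = "list_mat (\<lambda>x y. if x = y then d x else 0) xs xs"
  have "upper_triangular ?D"
    unfolding upper_triangular_def by (auto simp: nth_eq_iff_index_eq assms)
  then have "char_poly ?D = (\<Prod>a\<leftarrow>diag_mat ?D. [:- a, 1:])"
    by (rule char_poly_upper_triangular[OF list_mat_carrier])
  also have "diag_mat ?D = map d xs"
    by (rule nth_equalityI) (auto simp: diag_mat_def)
  also have "(\<Prod>a\<leftarrow>map d xs. [:- a, 1:]) = (\<Prod>x\<in>set xs. [:- d x, 1:])"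
    using assms by (simp add: prod.distinct_set_conv_list comp_def)
  finally show ?thesis .
qed

lemma sum_delta_mult_left:
  fixes f :: "'b \<Rightarrow> 'r :: semiring_1"
  assumes "finite S"
  shows "(\<Sum>y\<in>S. (if x = y then 1 else 0) * f y) = (if x \<in> S then f x else 0)"
proof -
  have "(\<Sum>y\<in>S. (if x = y then 1 else 0) * f y) = (\<Sum>y\<in>S. if x = y then f y else 0)"
    by (rule sum.cong) auto
  then show ?thesis using assms by simp
qed

lemma sum_delta_mult_right:
  fixes f :: "'b \<Rightarrow> 'r :: semiring_1"
  assumes "finite S"
  shows "(\<Sum>y\<in>S. f y * (if y = x then 1 else 0)) = (if x \<in> S then f x else 0)"
proof -
  have "(\<Sum>y\<in>S. f y * (if y = x then 1 else 0)) = (\<Sum>y\<in>S. if y = x then f y else 0)"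
    by (rule sum.cong) auto
  then show ?thesis using assms by simp
qed

text \<open>The two matrices are conjugate by the permutation matrix
  \<open>list_mat ?\<delta> xs ys\<close>, whose inverse is \<open>list_mat ?\<delta> ys xs\<close>.
  The spectrum is thus independent of the enumeration of the vertices, and lines may be listed
  first.\<close>

lemma char_poly_list_mat_perm:
  fixes f :: "'b \<Rightarrow> 'b \<Rightarrow> 'r :: comm_ring_1"
  assumes "distinct xs" "distinct ys" "set xs = set ys"
  shows "char_poly (list_mat f xs xs) = char_poly (list_mat f ys ys)"
proof -
  let ?\<delta> = "\<lambda>x y. if x = y then 1 else (0::'r)"
  have len: "length ys = length xs"
    by (rule distinct_card[OF assms(1), unfolded assms(3) distinct_card[OF assms(2)]])
  have carrier: "{list_mat f xs xs, list_mat f ys ys, list_mat ?\<delta> xs ys, list_mat ?\<delta> ys xs}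
      \<subseteq> carrier_mat (length xs) (length xs)"
    by (intro insert_subsetI empty_subsetI carrier_matI) (simp_all only: dim_list_mat len)
  have 1: "list_mat ?\<delta> xs ys * list_mat ?\<delta> ys xs = 1\<^sub>m (length xs)"
    unfolding list_mat_mult[OF assms(2)] list_mat_one[OF assms(1), symmetric]
    by (rule list_mat_cong) (simp add: assms(3)[symmetric] sum_delta_mult_left sum_delta_mult_right)
  have 2: "list_mat ?\<delta> ys xs * list_mat ?\<delta> xs ys = 1\<^sub>m (length xs)"
    unfolding list_mat_mult[OF assms(1)] len[symmetric] list_mat_one[OF assms(2), symmetric]
    by (rule list_mat_cong) (simp add: assms(3)[symmetric] sum_delta_mult_left sum_delta_mult_right)
  have 3: "list_mat f xs xs = list_mat ?\<delta> xs ys * list_mat f ys ys * list_mat ?\<delta> ys xs"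
    unfolding list_mat_mult[OF assms(2)]
    by (rule list_mat_cong) (simp add: assms(3)[symmetric] sum_delta_mult_left sum_delta_mult_right)
  show ?thesis
    by (rule char_poly_similar, rule similar_matI[OF carrier 1 2 3])
qed

text \<open>The characteristic matrix has two diagonal blocks \<open>?X\<close>, so its determinant
  is that of \<open>?X * ?X\<close> minus the product of the off-diagonal blocks. That difference is
  the characteristic matrix of \<open>A * B\<close> with X replaced by its square.\<close>

lemma char_poly_bipartite:
  fixes A B :: "'r :: idom mat"
  assumes A: "A \<in> carrier_mat n n" and B: "B \<in> carrier_mat n n"
  shows "char_poly (four_block_mat (0\<^sub>m n n) A B (0\<^sub>m n n)) =
    pcompose (char_poly (A * B)) [:0, 0, 1:]"
proof -
  let ?c = "map_mat (\<lambda>a. [:- a:])"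
  let ?X = "[:0, 1:] \<cdot>\<^sub>m 1\<^sub>m n :: 'r poly mat"
  have "char_poly_matrix (four_block_mat (0\<^sub>m n n) A B (0\<^sub>m n n)) =
      four_block_mat ?X (?c A) (?c B) ?X"
    unfolding char_poly_matrix_def by (rule eq_matI) (use A B in auto)
  then have "char_poly (four_block_mat (0\<^sub>m n n) A B (0\<^sub>m n n)) =
      det (four_block_mat ?X (?c A) (?c B) ?X)"
    by (simp add: char_poly_def)
  also have "\<dots> = det (?X * ?X - ?c A * ?c B)"
  proof (rule det_four_block_mat)
    \<comment> \<open>The block determinant formula asks the two lower blocks to commute; here one
      of them is a scalar matrix.\<close>
    show "?c B * ?X = ?X * ?c B"
      using B by (simp add: mult_smult_distrib[of _ n n _ n] mult_smult_assoc_mat[of _ n n _ n])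
  qed (use A B in auto)
  also have "?X * ?X - ?c A * ?c B =
      map_mat (\<lambda>p. pcompose p [:0, 0, 1:]) (char_poly_matrix (A * B))" (is "?L = ?R")
  proof (rule eq_matI)
    fix i j assume "i < dim_row ?R" "j < dim_col ?R"
    then have ij: "i < n" "j < n" using A B by (auto simp: char_poly_matrix_def)
    have "(?X * ?X) $$ (i, j) = (if i = j then [:0, 0, 1:] else 0)"
      using ij by (simp add: mult_smult_distrib[of _ n n _ n] mult_smult_assoc_mat[of _ n n _ n])
    moreover have "(?c A * ?c B) $$ (i, j) = [:(A * B) $$ (i, j):]"
    proof -
      have "(?c A * ?c B) $$ (i, j) = (\<Sum>k<n. [:A $$ (i, k) * B $$ (k, j):])"
        using ij A B by (simp add: scalar_prod_def lessThan_atLeast0 mult.commute)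
      also have "\<dots> = [:(\<Sum>k<n. A $$ (i, k) * B $$ (k, j)):]"
        by (induction n) auto
      also have "(\<Sum>k<n. A $$ (i, k) * B $$ (k, j)) = (A * B) $$ (i, j)"
        using ij A B by (simp add: scalar_prod_def lessThan_atLeast0 mult.commute)
      finally show ?thesis .
    qed
    ultimately show "?L $$ (i, j) = ?R $$ (i, j)"
      using ij A B by (auto simp: char_poly_matrix_def pcompose_pCons)
  qed (use A B in \<open>auto simp: char_poly_matrix_def\<close>)
  \<comment> \<open>Substituting the square of X is a ring homomorphism and hence commutes with the
    determinant.\<close>
  also have "det \<dots> = pcompose (char_poly (A * B)) [:0, 0, 1:]"
    unfolding char_poly_def by (rule comm_ring_hom.hom_det[OF pcompose_hom.comm_ring_hom_axioms])
  finally show ?thesis .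
qed

text \<open>Both diagonal blocks vanish, and equal lengths make all four blocks square. With the
  \<open>Inr\<close> part first, the product of the off-diagonal blocks is indexed by
  \<open>ys\<close> and its entries are sums over \<open>xs\<close>.\<close>

lemma char_poly_list_mat_bipartite:
  fixes f :: "'b + 'c \<Rightarrow> 'b + 'c \<Rightarrow> 'r :: idom"
  assumes "distinct xs" "distinct ys" "length xs = length ys"
    and "\<And>x x'. f (Inl x) (Inl x') = 0" "\<And>y y'. f (Inr y) (Inr y') = 0"
  shows "char_poly (list_mat f (map Inr ys @ map Inl xs) (map Inr ys @ map Inl xs)) =
    pcompose (char_poly (list_mat (\<lambda>y y'. \<Sum>x\<in>set xs. f (Inr y) (Inl x) * f (Inl x) (Inr y')) ys ys))
      [:0, 0, 1:]"
proof -
  let ?n = "length ys"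
  have "list_mat f (map Inr ys @ map Inl xs) (map Inr ys @ map Inl xs) =
      four_block_mat (0\<^sub>m ?n ?n) (list_mat (\<lambda>y x. f (Inr y) (Inl x)) ys xs)
        (list_mat (\<lambda>x y. f (Inl x) (Inr y)) xs ys) (0\<^sub>m ?n ?n)"
    by (rule eq_matI) (auto simp: assms nth_append)
  moreover have "char_poly (four_block_mat (0\<^sub>m ?n ?n) (list_mat (\<lambda>y x. f (Inr y) (Inl x)) ys xs)
      (list_mat (\<lambda>x y. f (Inl x) (Inr y)) xs ys) (0\<^sub>m ?n ?n)) =
    pcompose (char_poly (list_mat (\<lambda>y x. f (Inr y) (Inl x)) ys xs *
      list_mat (\<lambda>x y. f (Inl x) (Inr y)) xs ys)) [:0, 0, 1:]"
    by (rule char_poly_bipartite) (metis list_mat_carrier assms(3))+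
  ultimately show ?thesis
    by (simp only: list_mat_mult[OF assms(1)])
qed

text \<open>Column \<open>y\<close> of \<open>F\<close> is an eigenvector of \<open>M\<close> for
  \<open>d y\<close>, and \<open>G\<close> is a left inverse of \<open>F\<close>. For square
  matrices a left inverse is two-sided, so \<open>M\<close> is similar to the diagonal matrix of the
  \<open>d x\<close>.\<close>

lemma char_poly_list_mat_diagonalizable:
  fixes M F G :: "'b \<Rightarrow> 'b \<Rightarrow> 'r :: field"
  assumes xs: "distinct xs"
    and GF: "\<And>x y. x \<in> set xs \<Longrightarrow> y \<in> set xs \<Longrightarrow>
      (\<Sum>z\<in>set xs. G x z * F z y) = (if x = y then 1 else 0)"
    and MF: "\<And>x y. x \<in> set xs \<Longrightarrow> y \<in> set xs \<Longrightarrow> (\<Sum>z\<in>set xs. M x z * F z y) = d y * F x y"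
  shows "char_poly (list_mat M xs xs) = (\<Prod>x\<in>set xs. [:- d x, 1:])"
proof -
  let ?n = "length xs"
  let ?M = "list_mat M xs xs" and ?F = "list_mat F xs xs" and ?G = "list_mat G xs xs"
  let ?D = "list_mat (\<lambda>x y. if x = y then d x else 0) xs xs"
  have GF1: "?G * ?F = 1\<^sub>m ?n"
    unfolding list_mat_mult[OF xs] list_mat_one[OF xs, symmetric]
    by (rule list_mat_cong) (rule GF)
  have FG1: "?F * ?G = 1\<^sub>m ?n"
    by (rule mat_mult_left_right_inverse[OF list_mat_carrier list_mat_carrier GF1])
  have "?M * ?F = ?F * ?D"
    unfolding list_mat_mult[OF xs]
    by (rule list_mat_cong) (simp add: MF if_distrib[of "\<lambda>u. _ * u"] mult.commute[of _ "d _"] cong: if_cong)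
  then have "?F * ?D * ?G = ?M * (?F * ?G)"
    by (metis assoc_mult_mat[OF list_mat_carrier list_mat_carrier list_mat_carrier])
  then have "?M = ?F * ?D * ?G"
    by (simp add: FG1 right_mult_one_mat[OF list_mat_carrier])
  then have "similar_mat ?M ?D"
    by (intro similar_matI[OF _ FG1 GF1]) auto
  then show ?thesis
    by (simp add: char_poly_similar char_poly_list_mat_diag[OF xs])
qed

section \<open>Multiplicities of roots in products of polynomials\<close>

lemma order_prod_sum:
  fixes f :: "'b \<Rightarrow> 'r :: idom poly"
  assumes "finite S" "\<And>x. x \<in> S \<Longrightarrow> f x \<noteq> 0"
  shows "order r (\<Prod>x\<in>S. f x) = (\<Sum>x\<in>S. order r (f x))"
  using assms by (induction S) (auto simp: order_mult order_1_eq_0)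

text \<open>If \<open>r\<close> is a root, the polynomial is (X - r)(X + r), and the two factors
  coincide exactly for \<open>r = 0\<close>. This is the source of the factor 2 in the multiplicity
  of the eigenvalue 0.\<close>

lemma order_X2_minus_const:
  "order r [:- d, 0, 1:] = (if r\<^sup>2 = d then if r = 0 then 2 else 1 else 0)" for r d :: real
proof (cases "r\<^sup>2 = d")
  case True
  have "[:- d, 0, 1:] = [:- r, 1:] * [:- (- r), 1:]"
    using True by (simp add: power2_eq_square)
  moreover have "order r ([:- r, 1:] * [:- (- r), 1:]) = order r [:- r, 1:] + order r [:- (- r), 1:]"
    by (rule order_mult) auto
  moreover have lin: "order r [:- r, 1:] = 1"
    using order_power_n_n[of r 1] by (simp only: power_one_right)
  moreover have "order r [:- (- r), 1:] = (if r = 0 then 1 else 0)"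
  proof (cases "r = 0")
    case True
    then show ?thesis using lin by (simp only: minus_zero simp_thms if_True)
  qed (auto intro!: order_0I)
  ultimately show ?thesis
    using True by (simp only: if_True) simp
next
  case False
  then show ?thesis
    by (auto intro!: order_0I simp: power2_eq_square)
qed

section \<open>Additive characters of a finite field\<close>

lemma cis_int_mult_eq_one:
  fixes k p :: int
  assumes "p \<noteq> 0" "p dvd k"
  shows "cis (2 * pi * of_int k / of_int p) = 1"
proof -
  obtain j where "k = p * j" using assms by blast
  then have "2 * pi * of_int k / of_int p = 2 * pi * of_int j"
    using assms by simp
  then show ?thesis by (simp only: cis_multiple_2pi Ints_of_int)
qed

definition additive_subgroup :: "'a :: ab_group_add set \<Rightarrow> bool" where
  "additive_subgroup H \<longleftrightarrow> 0 \<in> H \<and> (\<forall>x\<in>H. \<forall>y\<in>H. x - y \<in> H)"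

lemma additive_subgroup_zero: "additive_subgroup H \<Longrightarrow> 0 \<in> H"
  unfolding additive_subgroup_def by (rule conjunct1)

lemma additive_subgroup_diff: "additive_subgroup H \<Longrightarrow> x \<in> H \<Longrightarrow> y \<in> H \<Longrightarrow> x - y \<in> H"
  unfolding additive_subgroup_def by meson

text \<open>A proper additive subgroup of maximal size has every outside element generating the quotient.\<close>

lemma exists_proper_subgroup_with_cyclic_quotient:
  "\<exists>(H :: 'a :: {field, finite} set) g. additive_subgroup H \<and> g \<notin> H \<and>
    (\<forall>x. \<exists>k::int. x - of_int k * g \<in> H)"
proof -
  let ?P = "\<lambda>H :: 'a set. additive_subgroup H \<and> H \<noteq> UNIV"
  have "{0} \<noteq> (UNIV :: 'a set)" by (metis UNIV_I singletonD zero_neq_one)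
  then have "?P {0}" by (simp add: additive_subgroup_def)
  then have "\<exists>H. ?P H \<and> (\<forall>K. ?P K \<longrightarrow> card K \<le> card H)"
    by (rule ex_has_greatest_nat[where b = "Suc (card (UNIV :: 'a set))"]) (simp add: card_mono less_Suc_eq_le)
  then obtain H where H: "?P H" and max: "\<And>K. ?P K \<Longrightarrow> card K \<le> card H"
    by blast
  note H0 = additive_subgroup_zero[OF conjunct1[OF H]]
    and Hdiff = additive_subgroup_diff[OF conjunct1[OF H]]
  obtain g where g: "g \<notin> H" using H by blast
  \<comment> \<open>This is the subgroup generated by \<open>H\<close> and \<open>g\<close>. It
    strictly contains \<open>H\<close>, so by maximality it cannot be proper.\<close>
  let ?K = "{x. \<exists>k::int. x - of_int k * g \<in> H}"
  have "?K = UNIV"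
  proof (rule ccontr)
    assume neq: "?K \<noteq> UNIV"
    have K0: "0 \<in> ?K" using H0 by (auto intro!: exI[of _ 0])
    have Kdiff: "x - y \<in> ?K" if xy: "x \<in> ?K" "y \<in> ?K" for x y
    proof -
      obtain k l :: int where "x - of_int k * g \<in> H" "y - of_int l * g \<in> H"
        using xy by blast
      then have "(x - of_int k * g) - (y - of_int l * g) \<in> H" by (rule Hdiff)
      then have "x - y - of_int (k - l) * g \<in> H" by (simp add: algebra_simps)
      then show ?thesis by blast
    qed
    have "additive_subgroup ?K"
      unfolding additive_subgroup_def by (intro conjI ballI K0 Kdiff)
    then have "card ?K \<le> card H" using neq by (intro max conjI)
    moreover have "H \<subset> ?K"
    proof
      show "H \<subseteq> ?K" by (auto intro!: exI[of _ 0])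
      have "g \<in> ?K" using H0 by (auto intro!: exI[of _ 1])
      then show "H \<noteq> ?K" using g by blast
    qed
    ultimately show False using psubset_card_mono[of ?K H] by simp
  qed
  then show ?thesis using H g by blast
qed

text \<open>Modulo \<open>H\<close> every \<open>x\<close> is an integer multiple of
  \<open>g\<close>, and the multiplier is determined modulo the characteristic p. Sending
  \<open>x\<close> to the p-th root of unity with that exponent is therefore a homomorphism, and it
  is nontrivial at \<open>g\<close>.\<close>

lemma exists_nontrivial_additive_character:
  "\<exists>\<chi> :: 'a :: {field, finite} \<Rightarrow> complex.
    (\<forall>x y. \<chi> (x + y) = \<chi> x * \<chi> y) \<and> \<chi> 0 = 1 \<and> (\<exists>g. \<chi> g \<noteq> 1)"
proof -
  obtain H :: "'a set" and g :: 'a where H: "additive_subgroup H" and g: "g \<notin> H"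
    and cyc: "\<And>x. \<exists>k::int. x - of_int k * g \<in> H"
    using exists_proper_subgroup_with_cyclic_quotient[where 'a = 'a] by metis
  note H0 = additive_subgroup_zero[OF H] and Hdiff = additive_subgroup_diff[OF H]
  define p where "p = int CHAR('a)"
  have "prime CHAR('a)" by (intro prime_CHAR_semidom finite_imp_CHAR_pos finite_UNIV)
  then have p: "prime p" by (simp add: p_def)
  have Hadd: "x + y \<in> H" if "x \<in> H" "y \<in> H" for x y
    using Hdiff[of x "0 - y"] Hdiff[of 0 y] H0 that by simp
  have Hmult: "of_int k * x \<in> H" if "x \<in> H" for k :: int and x
  proof (induction k rule: int_induct[of _ 0])
    case base then show ?case using H0 by simp
  next
    case (step1 i) then show ?case using Hadd that by (simp add: distrib_right)
  next
    case (step2 i) then show ?case using Hdiff that by (simp add: left_diff_distrib)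
  qed
  \<comment> \<open>Otherwise \<open>k\<close> is invertible modulo \<open>p\<close> by Bezout, and
    \<open>g\<close> would be an integer multiple of an element of \<open>H\<close>.\<close>
  have dvd: "p dvd k" if "of_int k * g \<in> H" for k :: int
  proof (rule ccontr)
    assume "\<not> p dvd k"
    then have "coprime p k" using p by (simp add: prime_imp_coprime)
    then obtain u v where "p * u + k * v = 1"
      using bezout_int[of p k] by (metis coprime_imp_gcd_eq_1 mult.commute)
    then have "(of_int (p * u + k * v) :: 'a) = 1" by simp
    then have "of_int v * (of_int k :: 'a) = 1"
      by (simp add: p_def mult.commute)
    then have "g = of_int v * (of_int k * g)" by (simp flip: mult.assoc)
    then show False using g Hmult[OF that] by metis
  qed
  \<comment> \<open>Any choice serves: by \<open>dvd\<close>, two admissible integers differ by a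
    multiple of \<open>p\<close>, which leaves the value of \<open>cis\<close> unchanged.\<close>
  define c where "c x = (SOME k::int. x - of_int k * g \<in> H)" for x
  have c: "x - of_int (c x) * g \<in> H" for x
    unfolding c_def by (rule someI_ex) (rule cyc)
  define \<chi> where "\<chi> x = cis (2 * pi * of_int (c x) / of_int p)" for x
  have p0: "p \<noteq> 0" using p by auto
  have cong: "cis (2 * pi * of_int k / of_int p) = cis (2 * pi * of_int l / of_int p)"
    if "p dvd k - l" for k l :: int
  proof -
    have "cis (2 * pi * of_int k / of_int p) =
        cis (2 * pi * of_int (k - l) / of_int p) * cis (2 * pi * of_int l / of_int p)"
      by (simp add: cis_mult flip: add_divide_distrib) (simp add: algebra_simps)
    then show ?thesis using cis_int_mult_eq_one[OF p0 that] by simp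
  qed
  have "\<chi> (x + y) = \<chi> x * \<chi> y" for x y
  proof -
    have "(x - of_int (c x) * g) + (y - of_int (c y) * g) - (x + y - of_int (c (x + y)) * g) \<in> H"
      by (intro Hadd Hdiff c)
    then have "of_int (c (x + y) - (c x + c y)) * g \<in> H"
      by (simp add: algebra_simps)
    from cong[OF dvd[OF this]] show ?thesis
      by (simp add: \<chi>_def cis_mult ring_distribs add_divide_distrib)
  qed
  moreover have "\<chi> 0 = 1"
  proof -
    have "of_int (c 0) * g \<in> H" using Hdiff[OF H0 c[of 0]] by simp
    then show ?thesis unfolding \<chi>_def by (intro cis_int_mult_eq_one p0 dvd)
  qed
  moreover have "\<chi> g \<noteq> 1"
  proof
    \<comment> \<open>Hence \<open>c g\<close> is 1 modulo \<open>p\<close> and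
      \<open>\<chi> g\<close> has angle \<open>2 * pi / p\<close>; if it were 1, then
      \<open>p\<close> would divide 1.\<close>
    have "of_int (c g - 1) * g \<in> H"
      using Hdiff[OF H0 c[of g]] by (simp add: algebra_simps)
    from cong[OF dvd[OF this]] have eq: "\<chi> g = cis (2 * pi / of_int p)"
      by (simp add: \<chi>_def)
    assume "\<chi> g = 1"
    then have "cos (2 * pi / of_int p) = 1" using eq by (simp add: complex_eq_iff)
    then obtain n :: int where "2 * pi / of_int p = of_int n * 2 * pi"
      using cos_one_2pi_int by auto
    then have "(1::real) = of_int (n * p)" using p0 by (simp add: field_simps)
    then have "n * p = 1" by linarith
    then show False using p by (metis dvd_triv_right not_prime_unit)
  qed
  ultimately show ?thesis by blast
qed

text \<open>For nonzero \<open>a\<close>, translating \<open>t\<close> by \<open>g / a\<close>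
  multiplies the sum by \<open>\<chi> g\<close>, which differs from 1, so the sum is 0. For
  \<open>a = 0\<close> every term is 1.\<close>

lemma sum_additive_character:
  fixes \<chi> :: "'a :: {field, finite} \<Rightarrow> complex"
  assumes add: "\<And>x y. \<chi> (x + y) = \<chi> x * \<chi> y" and zero: "\<chi> 0 = 1" and g: "\<chi> g \<noteq> 1"
  shows "(\<Sum>t\<in>UNIV. \<chi> (t * a)) = (if a = 0 then of_nat (card (UNIV :: 'a set)) else 0)"
proof (cases "a = 0")
  case False
  let ?S = "\<Sum>t\<in>UNIV. \<chi> (t * a)"
  have shift: "(t + g / a) * a = g + t * a" for t
    using False by (simp add: field_simps)
  have "?S = (\<Sum>t\<in>UNIV. \<chi> ((t + g / a) * a))"
    by (rule sum.reindex_bij_witness[of _ "\<lambda>t. t + g / a" "\<lambda>t. t - g / a"]) auto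
  also have "\<dots> = \<chi> g * ?S"
    by (simp add: shift add sum_distrib_left)
  finally show ?thesis using g False by simp
qed (simp add: zero)

section \<open>Incidence and characters\<close>

abbreviation jw_vectors :: "nat \<Rightarrow> (nat \<Rightarrow> 'a) set" where
  "jw_vectors m \<equiv> {1..m+1} \<rightarrow>\<^sub>E UNIV"

text \<open>
  With \<open>jw_exponent m 1 = 0\<close>, both kinds of incidence equations read
  \<open>l\<^sub>k + p\<^sub>k = p\<^sub>1\<^sup>w l\<^sub>1\<close> for \<open>w = jw_exponent m k\<close>.
\<close>

definition jw_exponent :: "nat \<Rightarrow> nat \<Rightarrow> nat" where
  "jw_exponent m k = (if k = m + 1 then m + 2 else k - 1)"

text \<open>This is the polynomial \<open>f\<^sub>c\<close>: for positive \<open>m\<close> it has no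
  monomials of degree \<open>m\<close> and \<open>m + 1\<close>, which matches the shape counted by
  \<open>N\<^sub>i\<close>.\<close>

definition jw_poly :: "nat \<Rightarrow> (nat \<Rightarrow> 'a::field) \<Rightarrow> 'a poly" where
  "jw_poly m c = (\<Sum>k\<in>{1..m+1}. monom (c k) (jw_exponent m k))"

text \<open>Over a finite field the zero polynomial gets the value q here; this yields the
  eigenvalues q and -q of the graph.\<close>

definition num_roots :: "'a::field poly \<Rightarrow> nat" where
  "num_roots f = card {x. poly f x = 0}"

lemma poly_jw_poly: "poly (jw_poly m c) x = (\<Sum>k\<in>{1..m+1}. c k * x ^ jw_exponent m k)"
  by (simp add: jw_poly_def poly_sum poly_monom)

section \<open>Parametrization of the points on a line and of the lines through a point\<close>

lemma jw_incident_iff: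
  assumes "m \<ge> 1"
  shows "jw_incident m p l \<longleftrightarrow> (\<forall>k\<in>{2..m+1}. l k + p k = p 1 ^ jw_exponent m k * l 1)"
proof -
  have "{2..m+1} = insert (m + 1) {2..m}" using assms by auto
  then show ?thesis
    unfolding jw_incident_def by (auto simp: jw_exponent_def)
qed

text \<open>The point on the line \<open>l\<close> with first coordinate \<open>x\<close>: the
  incidence equations determine all further coordinates. \<open>jw_line\<close> is the dual
  construction.\<close>

definition jw_point :: "nat \<Rightarrow> (nat \<Rightarrow> 'a::field) \<Rightarrow> 'a \<Rightarrow> nat \<Rightarrow> 'a" where
  "jw_point m l x = (\<lambda>k\<in>{1..m+1}. if k = 1 then x else x ^ jw_exponent m k * l 1 - l k)"

definition jw_line :: "nat \<Rightarrow> (nat \<Rightarrow> 'a::field) \<Rightarrow> 'a \<Rightarrow> nat \<Rightarrow> 'a" where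
  "jw_line m p t = (\<lambda>k\<in>{1..m+1}. if k = 1 then t else p 1 ^ jw_exponent m k * t - p k)"

lemma sum_incident_points:
  fixes l :: "nat \<Rightarrow> 'a::{field,finite}"
  assumes "m \<ge> 1"
  shows "(\<Sum>p\<in>{p \<in> jw_vectors m. jw_incident m p l}. g p) = (\<Sum>x\<in>UNIV. g (jw_point m l x))"
proof (rule sum.reindex_bij_witness[where j = "\<lambda>p. p 1" and i = "jw_point m l"])
  fix p assume p: "p \<in> {p \<in> jw_vectors m. jw_incident m p l}"
  show "jw_point m l (p 1) = p"
  proof
    fix k
    consider "k \<notin> {1..m+1}" | "k = 1" | "k \<in> {2..m+1}" by fastforce
    then show "jw_point m l (p 1) k = p k"
    proof cases
      case 1 then show ?thesis using p by (auto simp: jw_point_def PiE_def extensional_def)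
    next
      case 2 then show ?thesis by (simp add: jw_point_def)
    next
      case 3
      then have "l k + p k = p 1 ^ jw_exponent m k * l 1"
        using p by (simp add: jw_incident_iff[OF assms])
      then have "p k = p 1 ^ jw_exponent m k * l 1 - l k" by (simp add: eq_diff_eq add.commute)
      then show ?thesis using 3 by (simp add: jw_point_def)
    qed
  qed
  then show "g (jw_point m l (p 1)) = g p" by simp
qed (auto simp: jw_incident_iff[OF assms] jw_point_def)

lemma sum_incident_lines:
  fixes p :: "nat \<Rightarrow> 'a::{field,finite}"
  assumes "m \<ge> 1"
  shows "(\<Sum>l\<in>{l \<in> jw_vectors m. jw_incident m p l}. g l) = (\<Sum>t\<in>UNIV. g (jw_line m p t))"
proof (rule sum.reindex_bij_witness[where j = "\<lambda>l. l 1" and i = "jw_line m p"])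
  fix l assume l: "l \<in> {l \<in> jw_vectors m. jw_incident m p l}"
  show "jw_line m p (l 1) = l"
  proof
    fix k
    consider "k \<notin> {1..m+1}" | "k = 1" | "k \<in> {2..m+1}" by fastforce
    then show "jw_line m p (l 1) k = l k"
    proof cases
      case 1 then show ?thesis using l by (auto simp: jw_line_def PiE_def extensional_def)
    next
      case 2 then show ?thesis by (simp add: jw_line_def)
    next
      case 3
      then have "l k + p k = p 1 ^ jw_exponent m k * l 1"
        using l by (simp add: jw_incident_iff[OF assms])
      then have "l k = p 1 ^ jw_exponent m k * l 1 - p k" by (simp add: eq_diff_eq)
      then show ?thesis using 3 by (simp add: jw_line_def)
    qed
  qed
  then show "g (jw_line m p (l 1)) = g l" by simp
qed (auto simp: jw_incident_iff[OF assms] jw_line_def)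

text \<open>Moving from \<open>l\<close> through its point at \<open>x\<close> to the line with
  first coordinate \<open>t\<close> adds \<open>(t - l 1) * x ^ jw_exponent m k\<close> to
  coordinate \<open>k\<close>, including \<open>k = 1\<close>, where the exponent is 0. Pairing with
  \<open>c\<close> assembles these increments into a value of \<open>f\<^sub>c\<close>.\<close>

lemma sum_jw_line_jw_point:
  fixes c l :: "nat \<Rightarrow> 'a::field"
  assumes "m \<ge> 1"
  shows "(\<Sum>k\<in>{1..m+1}. c k * jw_line m (jw_point m l x) t k) =
    (\<Sum>k\<in>{1..m+1}. c k * l k) + (t - l 1) * poly (jw_poly m c) x"
proof -
  have "jw_line m (jw_point m l x) t k = l k + (t - l 1) * x ^ jw_exponent m k"
    if "k \<in> {1..m+1}" for k
    using that assms by (auto simp: jw_line_def jw_point_def jw_exponent_def algebra_simps)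
  then have "(\<Sum>k\<in>{1..m+1}. c k * jw_line m (jw_point m l x) t k) =
      (\<Sum>k\<in>{1..m+1}. c k * (l k + (t - l 1) * x ^ jw_exponent m k))"
    by (intro sum.cong) (auto simp del: atLeastAtMost_iff)
  also have "\<dots> = (\<Sum>k\<in>{1..m+1}. c k * l k) + (t - l 1) * poly (jw_poly m c) x"
    by (simp only: poly_jw_poly sum_distrib_left sum.distrib[symmetric])
      (intro sum.cong, auto simp: algebra_simps)
  finally show ?thesis .
qed

section \<open>Characters of the vector space as eigenvectors of the Gram matrix\<close>

context
  fixes \<chi> :: "'a::{field,finite} \<Rightarrow> complex"
  assumes add: "\<And>x y. \<chi> (x + y) = \<chi> x * \<chi> y" and zero: "\<chi> 0 = 1"
    and nontrivial: "\<exists>g. \<chi> g \<noteq> 1"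
begin

lemma sum_character: "(\<Sum>t\<in>UNIV. \<chi> (t * a)) = (if a = 0 then of_nat (card (UNIV :: 'a set)) else 0)"
  using nontrivial sum_additive_character[of \<chi>, OF add zero] by blast

lemma character_sum: "finite S \<Longrightarrow> \<chi> (\<Sum>k\<in>S. f k) = (\<Prod>k\<in>S. \<chi> (f k))"
  by (induction S rule: finite_induct) (simp_all add: add zero)

text \<open>The sum over vectors factors into one character sum per coordinate, and each of these
  vanishes unless \<open>c\<close> and \<open>d\<close> agree there. In matrix terms, this exhibits
  the inverse of the character table.\<close>

lemma vector_character_orthogonality:
  fixes c d :: "nat \<Rightarrow> 'a"
  assumes "c \<in> jw_vectors m" "d \<in> jw_vectors m"
  shows "(\<Sum>z\<in>jw_vectors m. \<chi> (- (\<Sum>k\<in>{1..m+1}. c k * z k)) / of_nat (card (UNIV :: 'a set)) ^ (m + 1) *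
      \<chi> (\<Sum>k\<in>{1..m+1}. d k * z k)) = (if c = d then 1 else 0)"
proof -
  let ?q = "of_nat (card (UNIV :: 'a set)) :: complex"
  have "(\<Sum>z\<in>jw_vectors m. \<chi> (- (\<Sum>k\<in>{1..m+1}. c k * z k)) / ?q ^ (m + 1) *
      \<chi> (\<Sum>k\<in>{1..m+1}. d k * z k)) =
    (\<Sum>z\<in>jw_vectors m. (\<Prod>k\<in>{1..m+1}. \<chi> (z k * (d k - c k)))) / ?q ^ (m + 1)"
    unfolding sum_divide_distrib
    by (intro sum.cong refl)
      (simp add: character_sum[symmetric] add[symmetric] sum_subtractf algebra_simps)
  also have "(\<Sum>z\<in>jw_vectors m. (\<Prod>k\<in>{1..m+1}. \<chi> (z k * (d k - c k)))) =
      (\<Prod>k\<in>{1..m+1}. \<Sum>t\<in>UNIV. \<chi> (t * (d k - c k)))"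
    by (subst prod_sum_PiE) auto
  also have "\<dots> = (\<Prod>k\<in>{1..m+1}. if d k = c k then ?q else 0)"
    by (simp add: sum_character)
  also have "\<dots> = (if c = d then ?q ^ (m + 1) else 0)"
  proof (cases "c = d")
    case False
    \<comment> \<open>Both functions are extensional, so a difference must occur at a coordinate of
      the index range.\<close>
    then obtain k where "k \<in> {1..m+1}" "c k \<noteq> d k"
      using PiE_ext[OF assms] by blast
    then show ?thesis using False by (intro trans[OF prod_zero]) (auto intro!: bexI[of _ k])
  qed simp
  finally show ?thesis by simp
qed

text \<open>A Gram entry counts the points common to two lines. After exchanging the sums, the
  character is summed over the points of \<open>l\<close>, indexed by \<open>x\<close>, and the
  lines through them, indexed by \<open>t\<close>. The inner sum over \<open>t\<close> is q times
  the character at \<open>l\<close> if \<open>x\<close> is a root of \<open>f\<^sub>c\<close>, and 0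
  otherwise.\<close>

lemma vector_character_eigenvector:
  fixes c l :: "nat \<Rightarrow> 'a"
  assumes "m \<ge> 1"
  shows "(\<Sum>z\<in>jw_vectors m. of_real (\<Sum>p\<in>jw_vectors m.
        (if jw_incident m p l then 1 else 0) * (if jw_incident m p z then 1 else 0)) *
      \<chi> (\<Sum>k\<in>{1..m+1}. c k * z k)) =
    of_nat (card (UNIV :: 'a set) * num_roots (jw_poly m c)) * \<chi> (\<Sum>k\<in>{1..m+1}. c k * l k)"
proof -
  let ?\<psi> = "\<lambda>z. \<chi> (\<Sum>k\<in>{1..m+1}. c k * z k)"
  have fin: "finite (jw_vectors m :: (nat \<Rightarrow> 'a) set)" by (intro finite_PiE) auto
  have "(\<Sum>z\<in>jw_vectors m. of_real (\<Sum>p\<in>jw_vectors m.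
        (if jw_incident m p l then 1 else 0) * (if jw_incident m p z then 1 else 0)) * ?\<psi> z) =
      (\<Sum>z\<in>jw_vectors m. \<Sum>p\<in>jw_vectors m.
        if jw_incident m p l then (if jw_incident m p z then ?\<psi> z else 0) else 0)"
    by (intro sum.cong refl) (simp add: sum_distrib_right, intro sum.cong, auto)
  also have "\<dots> = (\<Sum>p\<in>jw_vectors m. \<Sum>z\<in>jw_vectors m.
        if jw_incident m p l then (if jw_incident m p z then ?\<psi> z else 0) else 0)"
    by (rule sum.swap)
  also have "\<dots> = (\<Sum>p\<in>jw_vectors m. if jw_incident m p l then
        (\<Sum>z\<in>jw_vectors m. if jw_incident m p z then ?\<psi> z else 0) else 0)"
    by (intro sum.cong) auto
  also have "\<dots> = (\<Sum>p\<in>{p \<in> jw_vectors m. jw_incident m p l}.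
      \<Sum>z\<in>{z \<in> jw_vectors m. jw_incident m p z}. ?\<psi> z)"
    using fin by (simp only: sum.inter_filter)
  also have "\<dots> = (\<Sum>x\<in>UNIV. \<Sum>t\<in>UNIV. ?\<psi> (jw_line m (jw_point m l x) t))"
    by (simp only: sum_incident_points[OF assms] sum_incident_lines[OF assms])
  also have "\<dots> = (\<Sum>x\<in>UNIV. ?\<psi> l * (\<Sum>t\<in>UNIV. \<chi> (t * poly (jw_poly m c) x)))"
  proof (intro sum.cong refl)
    fix x :: 'a
    have "(\<Sum>t\<in>UNIV. ?\<psi> (jw_line m (jw_point m l x) t)) =
        (\<Sum>t\<in>UNIV. ?\<psi> l * \<chi> ((t - l 1) * poly (jw_poly m c) x))"
      by (simp only: sum_jw_line_jw_point[OF assms] add)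
    \<comment> \<open>Translating \<open>t\<close> by \<open>l 1\<close> leaves \<open>l\<close>
      only in the factor \<open>?\<psi> l\<close>.\<close>
    also have "\<dots> = (\<Sum>t\<in>UNIV. ?\<psi> l * \<chi> (t * poly (jw_poly m c) x))"
      by (rule sum.reindex_bij_witness[of _ "\<lambda>t. t + l 1" "\<lambda>t. t - l 1"]) auto
    finally show "(\<Sum>t\<in>UNIV. ?\<psi> (jw_line m (jw_point m l x) t)) =
        ?\<psi> l * (\<Sum>t\<in>UNIV. \<chi> (t * poly (jw_poly m c) x))"
      by (simp only: sum_distrib_left)
  qed
  also have "\<dots> = ?\<psi> l * (\<Sum>x\<in>UNIV. if poly (jw_poly m c) x = 0 then of_nat (card (UNIV :: 'a set)) else 0)"
    by (simp only: sum_character sum_distrib_left)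
  also have "(\<Sum>x\<in>UNIV. if poly (jw_poly m c) x = 0 then of_nat (card (UNIV :: 'a set)) else 0) =
      (of_nat (card (UNIV :: 'a set) * num_roots (jw_poly m c)) :: complex)"
    by (simp add: num_roots_def flip: sum.inter_filter)
  finally show ?thesis by (simp only: mult.commute[of "?\<psi> l"])
qed

end

section \<open>Characteristic polynomials of the Gram matrix and of the graph\<close>

definition gram_eigenvalue :: "nat \<Rightarrow> (nat \<Rightarrow> 'a::field) \<Rightarrow> real" where
  "gram_eigenvalue m c = real (card (UNIV :: 'a set) * num_roots (jw_poly m c))"

text \<open>The eigenvectors are complex, so the diagonalization takes place over the complex
  numbers. Both sides have real coefficients, and injectivity of the embedding on polynomials brings
  the identity back to the reals.\<close>

lemma char_poly_incidence_gram:
  fixes ls :: "(nat \<Rightarrow> 'a::{field,finite}) list"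
  assumes m: "m \<ge> 1" and ls: "distinct ls" "set ls = jw_vectors m"
  shows "char_poly (list_mat (\<lambda>l z. \<Sum>p\<in>jw_vectors m.
      (if jw_incident m p l then 1 else 0) * (if jw_incident m p z then 1 else 0) :: real) ls ls) =
    (\<Prod>c\<in>jw_vectors m. [:- gram_eigenvalue m (c :: nat \<Rightarrow> 'a), 1:])"
    (is "char_poly (list_mat ?M ls ls) = (\<Prod>c\<in>_. [:- ?d c, 1:])")
proof -
  obtain \<chi> :: "'a \<Rightarrow> complex" where \<chi>: "\<And>x y. \<chi> (x + y) = \<chi> x * \<chi> y" "\<chi> 0 = 1" "\<exists>g. \<chi> g \<noteq> 1"
    using exists_nontrivial_additive_character[where 'a = 'a] by metis
  interpret map_poly_inj_comm_ring_hom "of_real :: real \<Rightarrow> complex" ..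
  let ?h = "of_real :: real \<Rightarrow> complex"
  have "char_poly (list_mat (\<lambda>l z. ?h (?M l z)) ls ls) = (\<Prod>c\<in>set ls. [:- ?h (?d c), 1:])"
  proof (rule char_poly_list_mat_diagonalizable[where
        F = "\<lambda>z c. \<chi> (\<Sum>k\<in>{1..m+1}. c k * z k)" and
        G = "\<lambda>c z. \<chi> (- (\<Sum>k\<in>{1..m+1}. c k * z k)) / of_nat (card (UNIV :: 'a set)) ^ (m + 1)"])
    fix x y assume "x \<in> set ls" "y \<in> set ls"
    then show "(\<Sum>z\<in>set ls. \<chi> (- (\<Sum>k\<in>{1..m+1}. x k * z k)) / of_nat (card (UNIV :: 'a set)) ^ (m + 1) *
        \<chi> (\<Sum>k\<in>{1..m+1}. y k * z k)) = (if x = y then 1 else 0)"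
      unfolding ls by (rule vector_character_orthogonality[of \<chi>, OF \<chi>])
    show "(\<Sum>z\<in>set ls. ?h (?M x z) * \<chi> (\<Sum>k\<in>{1..m+1}. y k * z k)) =
        ?h (?d y) * \<chi> (\<Sum>k\<in>{1..m+1}. y k * x k)"
      unfolding ls gram_eigenvalue_def of_real_of_nat_eq by (rule vector_character_eigenvector[of \<chi>, OF \<chi> m])
  qed (rule ls)
  moreover have "list_mat (\<lambda>l z. ?h (?M l z)) ls ls = map_mat ?h (list_mat ?M ls ls)"
    by (rule eq_matI) auto
  ultimately have "map_poly ?h (char_poly (list_mat ?M ls ls)) = (\<Prod>c\<in>set ls. [:- ?h (?d c), 1:])"
    by (simp only: of_real_hom.char_poly_hom[OF list_mat_carrier])
  also have "\<dots> = map_poly ?h (\<Prod>c\<in>set ls. [:- ?d c, 1:])"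
    by (simp add: hom_prod map_poly_pCons)
  finally show ?thesis
    unfolding ls(2) by (simp only: eq_iff)
qed

text \<open>The points and the lines are two copies of the same set of vectors, so one list
  \<open>ls\<close> enumerates both. Substituting the square of X turns each linear factor of the
  Gram matrix into a quadratic one.\<close>

lemma char_poly_jw:
  fixes vs :: "((nat \<Rightarrow> 'a::{field,finite}) + (nat \<Rightarrow> 'a)) list"
  assumes m: "m \<ge> 1" and vs: "distinct vs" "set vs = jw_vertices m"
  shows "char_poly (adjacency_matrix (jw_adj m) vs) =
    (\<Prod>c\<in>jw_vectors m. [:- gram_eigenvalue m (c :: nat \<Rightarrow> 'a), 0, 1:])"
proof -
  have fin: "finite (jw_vectors m :: (nat \<Rightarrow> 'a) set)" by (intro finite_PiE) auto
  obtain ls :: "(nat \<Rightarrow> 'a) list" where ls: "set ls = jw_vectors m" "distinct ls"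
    using finite_distinct_list[OF fin] by metis
  let ?f = "\<lambda>u v. if jw_adj m u v then 1 else 0 :: real"
  have "adjacency_matrix (jw_adj m) vs = list_mat ?f vs vs"
    by (simp add: adjacency_matrix_def list_mat_def)
  also have "char_poly \<dots> =
      char_poly (list_mat ?f (map Inr ls @ map Inl ls) (map Inr ls @ map Inl ls))"
  proof (rule char_poly_list_mat_perm)
    show "distinct (map Inr ls @ map Inl ls)"
      using ls(2) by (auto simp: distinct_map)
    show "set vs = set (map Inr ls @ map Inl ls)"
      unfolding vs(2) jw_vertices_def Plus_def by (simp only: set_append set_map ls(1) Un_commute)
  qed (rule vs)
  also have "\<dots> = pcompose (char_poly (list_mat (\<lambda>y y'. \<Sum>x\<in>set ls. ?f (Inr y) (Inl x) * ?f (Inl x) (Inr y')) ls ls))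
      [:0, 0, 1:]"
    by (rule char_poly_list_mat_bipartite[OF ls(2) ls(2) refl]) simp_all
  also have "\<dots> = pcompose (\<Prod>c\<in>jw_vectors m. [:- gram_eigenvalue m (c :: nat \<Rightarrow> 'a), 1:]) [:0, 0, 1:]"
    unfolding ls(1) jw_adj.simps by (subst char_poly_incidence_gram[OF m ls(2,1)]) (rule refl)
  also have "\<dots> = (\<Prod>c\<in>jw_vectors m. [:- gram_eigenvalue m (c :: nat \<Rightarrow> 'a), 0, 1:])"
    by (simp add: pcompose_prod pcompose_pCons)
  finally show ?thesis .
qed

lemma order_char_poly_jw:
  fixes vs :: "((nat \<Rightarrow> 'a::{field,finite}) + (nat \<Rightarrow> 'a)) list"
  assumes "m \<ge> 1" and "distinct vs" and "set vs = jw_vertices m"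
  shows "order r (char_poly (adjacency_matrix (jw_adj m) vs)) = (if r = 0 then 2 else 1) *
    card {c \<in> jw_vectors m. r\<^sup>2 = gram_eigenvalue m (c :: nat \<Rightarrow> 'a)}"
proof -
  have fin: "finite (jw_vectors m :: (nat \<Rightarrow> 'a) set)" by (intro finite_PiE) auto
  have "order r (char_poly (adjacency_matrix (jw_adj m) vs)) =
      (\<Sum>c\<in>jw_vectors m. if r\<^sup>2 = gram_eigenvalue m (c :: nat \<Rightarrow> 'a)
        then if r = 0 then 2 else 1 else 0)"
    unfolding char_poly_jw[OF assms] order_X2_minus_const[symmetric]
    by (rule order_prod_sum[OF fin]) simp
  also have "\<dots> = (if r = 0 then 2 else 1) *
    card {c \<in> jw_vectors m. r\<^sup>2 = gram_eigenvalue m (c :: nat \<Rightarrow> 'a)}"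
    by (simp only: sum.inter_filter[OF fin, symmetric]) simp
  finally show ?thesis .
qed

lemma eigenvalue_jw_iff:
  fixes vs :: "((nat \<Rightarrow> 'a::{field,finite}) + (nat \<Rightarrow> 'a)) list"
  assumes "m \<ge> 1" and "distinct vs" and "set vs = jw_vertices m"
  shows "eigenvalue (adjacency_matrix (jw_adj m) vs) r \<longleftrightarrow>
    (\<exists>c\<in>jw_vectors m. r\<^sup>2 = gram_eigenvalue m (c :: nat \<Rightarrow> 'a))"
proof -
  have fin: "finite (jw_vectors m :: (nat \<Rightarrow> 'a) set)" by (intro finite_PiE) auto
  have "adjacency_matrix (jw_adj m) vs \<in> carrier_mat (length vs) (length vs)"
    by (simp add: adjacency_matrix_def)
  moreover have "poly [:- d, 0, 1:] r = 0 \<longleftrightarrow> r\<^sup>2 = d" for d :: real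
    by (simp add: power2_eq_square)
  ultimately show ?thesis
    by (simp only: eigenvalue_root_char_poly char_poly_jw[OF assms] poly_prod prod_zero_iff[OF fin])
qed

section \<open>Counting polynomials by their number of roots\<close>

lemma pCons_image_degree:
  "{f. f \<noteq> 0 \<and> degree f = Suc d} = (\<lambda>(a, f). pCons a f) ` (UNIV \<times> {f. f \<noteq> 0 \<and> degree f = d})"
proof (intro subset_antisym subsetI)
  fix f :: "'a poly"
  assume f: "f \<in> {f. f \<noteq> 0 \<and> degree f = Suc d}"
  show "f \<in> (\<lambda>(a, f). pCons a f) ` (UNIV \<times> {f. f \<noteq> 0 \<and> degree f = d})"
  proof (cases f)
    case (pCons a g)
    then have "(a, g) \<in> UNIV \<times> {f. f \<noteq> 0 \<and> degree f = d}"
      using f by (simp split: if_splits)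
    then show ?thesis using pCons by (intro image_eqI[of _ _ "(a, g)"]) simp_all
  qed
qed auto

text \<open>There are q - 1 nonzero constants, and each further degree contributes a free constant
  coefficient through \<open>pCons\<close>. Finiteness is carried along in the induction for the
  later sums over these sets.\<close>

lemma card_nonzero_poly_degree:
  "card {f :: 'a::{field,finite} poly. f \<noteq> 0 \<and> degree f = d} =
    (card (UNIV :: 'a set) - 1) * card (UNIV :: 'a set) ^ d \<and>
  finite {f :: 'a poly. f \<noteq> 0 \<and> degree f = d}"
proof (induction d)
  case 0
  have eq: "{f :: 'a poly. f \<noteq> 0 \<and> degree f = 0} = (\<lambda>a. [:a:]) ` (UNIV - {0})"
    by (auto elim!: degree_eq_zeroE)
  have "inj_on (\<lambda>a :: 'a. [:a:]) (UNIV - {0})" by (auto intro: inj_onI)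
  then show ?case unfolding eq by (simp add: card_image card_Diff_subset)
next
  case (Suc d)
  have "inj_on (\<lambda>(a, f :: 'a poly). pCons a f) (UNIV \<times> {f. f \<noteq> 0 \<and> degree f = d})"
    by (simp add: inj_on_def)
  then show ?case
    unfolding pCons_image_degree using Suc by (simp add: card_image card_cartesian_product)
qed

lemma finite_poly_degree_le: "finite {f :: 'a::{field,finite} poly. degree f \<le> n}"
proof (rule finite_subset)
  show "{f :: 'a poly. degree f \<le> n} \<subseteq> insert 0 (\<Union>d\<le>n. {f. f \<noteq> 0 \<and> degree f = d})"
    by auto
  show "finite (insert 0 (\<Union>d\<le>n. {f :: 'a poly. f \<noteq> 0 \<and> degree f = d}))"
    using card_nonzero_poly_degree[where 'a = 'a] by simp
qed

text \<open>The product over the earlier points does not vanish at a new point \<open>x\<close>, so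
  the cofactor must, and it splits off another linear factor.\<close>

lemma prod_linear_dvd:
  fixes f :: "'a::field poly"
  assumes "finite S" "\<forall>x\<in>S. poly f x = 0"
  shows "(\<Prod>x\<in>S. [:- x, 1:]) dvd f"
  using assms
proof (induction S rule: finite_induct)
  case (insert x S)
  then obtain h where h: "f = (\<Prod>x\<in>S. [:- x, 1:]) * h" by (auto elim: dvdE)
  have "poly (\<Prod>x\<in>S. [:- x, 1:]) x \<noteq> 0"
    using insert.hyps by (auto simp: poly_prod)
  then have "poly h x = 0" using insert.prems h by auto
  then have "[:- x, 1:] dvd h" by (simp add: poly_eq_0_iff_dvd)
  then have "[:- x, 1:] * (\<Prod>x\<in>S. [:- x, 1:]) dvd h * (\<Prod>x\<in>S. [:- x, 1:])"
    by (rule mult_dvd_mono) (rule dvd_refl)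
  then show ?case
    by (simp only: prod.insert[OF insert.hyps] h mult.commute[of h])
qed simp

text \<open>Multiplication by the product of the X - x over \<open>S\<close> is a bijection from the
  nonzero polynomials of degree \<open>d - card S\<close>. If \<open>S\<close> has more than
  \<open>d\<close> elements, divisibility by that product contradicts the degree; the case split
  keeps truncated subtraction from giving a false count.\<close>

lemma card_poly_vanishing:
  fixes S :: "'a::{field,finite} set"
  shows "card {f :: 'a poly. f \<noteq> 0 \<and> degree f = d \<and> (\<forall>x\<in>S. poly f x = 0)} =
    (if card S \<le> d then (card (UNIV :: 'a set) - 1) * card (UNIV :: 'a set) ^ (d - card S) else 0)"
proof -
  let ?P = "\<Prod>x\<in>S. [:- x, 1:]" and ?A = "{f :: 'a poly. f \<noteq> 0 \<and> degree f = d \<and> (\<forall>x\<in>S. poly f x = 0)}"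
  have P0: "?P \<noteq> 0" by simp
  have degP: "degree ?P = card S" by (subst degree_prod_sum_eq) auto
  have deg: "degree (?P * h) = card S + degree h" if "h \<noteq> 0" for h
    using degree_mult_eq[OF P0 that] degP by simp
  have van: "poly (?P * h) x = 0" if "x \<in> S" for x h
    using that by (auto simp: poly_prod)
  show ?thesis
  proof (cases "card S \<le> d")
    case True
    have "?A = (\<lambda>h. ?P * h) ` {h. h \<noteq> 0 \<and> degree h = d - card S}"
    proof (intro subset_antisym subsetI)
      fix f assume f: "f \<in> ?A"
      then have "?P dvd f" by (intro prod_linear_dvd) auto
      then obtain h where h: "f = ?P * h" by (elim dvdE)
      then have "h \<noteq> 0" using f by auto
      then show "f \<in> (\<lambda>h. ?P * h) ` {h. h \<noteq> 0 \<and> degree h = d - card S}"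
        using h f deg[of h] by auto
    next
      fix f assume "f \<in> (\<lambda>h. ?P * h) ` {h. h \<noteq> 0 \<and> degree h = d - card S}"
      then obtain h where h: "f = ?P * h" "h \<noteq> 0" "degree h = d - card S" by blast
      have "f \<noteq> 0" using h P0 by simp
      moreover have "degree f = d" using deg[OF h(2)] h True by simp
      moreover have "\<forall>x\<in>S. poly f x = 0" using van h(1) by simp
      ultimately show "f \<in> ?A" by simp
    qed
    moreover have "inj_on (\<lambda>h. ?P * h) {h. h \<noteq> 0 \<and> degree h = d - card S}"
      using P0 by (intro inj_onI) simp
    ultimately show ?thesis
      using True card_nonzero_poly_degree[where 'a = 'a] by (simp add: card_image)
  next
    case False
    have "f \<notin> ?A" for f
    proof
      assume f: "f \<in> ?A"
      then have "?P dvd f" by (intro prod_linear_dvd) auto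
      then have "degree ?P \<le> degree f" using f by (intro dvd_imp_degree_le) auto
      then show False using f degP False by auto
    qed
    then have empty: "?A = {}" by blast
    show ?thesis using False by (simp only: empty card.empty if_False)
  qed
qed

section \<open>Inclusion-exclusion over root sets\<close>

lemma sum_Pow_card:
  fixes g :: "nat \<Rightarrow> int"
  assumes "finite A"
  shows "(\<Sum>T\<in>Pow A. g (card T)) = (\<Sum>k\<le>card A. int (card A choose k) * g k)"
proof -
  have "(\<Sum>T\<in>Pow A. g (card T)) = (\<Sum>k\<le>card A. \<Sum>T\<in>{T \<in> Pow A. card T = k}. g (card T))"
    by (rule sum.group[symmetric]) (use assms in \<open>auto intro: card_mono\<close>)
  also have "\<dots> = (\<Sum>k\<le>card A. int (card A choose k) * g k)"
    using n_subsets[OF assms] by (intro sum.cong refl) simp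
  finally show ?thesis .
qed

text \<open>The indicator of the root set being exactly \<open>S\<close> is the indicator of
  vanishing on \<open>S\<close> times the product, over x outside \<open>S\<close>, of 1 minus the
  indicator of vanishing at x. Expanding this product over the subsets \<open>T\<close> of the
  complement gives the signed sum.\<close>

lemma card_poly_root_set:
  fixes S :: "'a::{field,finite} set"
  shows "int (card {f :: 'a poly. f \<noteq> 0 \<and> degree f = d \<and> {x. poly f x = 0} = S}) =
    (\<Sum>T\<in>Pow (- S). (-1) ^ card T *
      int (card {f :: 'a poly. f \<noteq> 0 \<and> degree f = d \<and> (\<forall>x\<in>S \<union> T. poly f x = 0)}))"
proof -
  let ?D = "{f :: 'a poly. f \<noteq> 0 \<and> degree f = d}"
  have fin: "finite ?D" using card_nonzero_poly_degree by blast
  let ?v = "\<lambda>(f :: 'a poly) T. if \<forall>x\<in>T. poly f x = 0 then 1 else 0 :: int"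
  have prod_v: "(\<Prod>x\<in>T. ?v f {x}) = ?v f T" for f and T :: "'a set"
    by (auto intro: prod_zero)
  have count: "int (card {f. f \<noteq> 0 \<and> degree f = d \<and> Q f}) = (\<Sum>f\<in>?D. if Q f then 1 else 0)" for Q
    using fin by (simp add: sum.inter_filter[symmetric] conj_assoc)
  have "int (card {f :: 'a poly. f \<noteq> 0 \<and> degree f = d \<and> {x. poly f x = 0} = S}) =
      (\<Sum>f\<in>?D. ?v f S * (\<Prod>x\<in>-S. 1 - ?v f {x}))"
    unfolding count
  proof (intro sum.cong refl)
    fix f
    show "(if {x. poly f x = 0} = S then 1 else 0) = ?v f S * (\<Prod>x\<in>-S. 1 - ?v f {x})"
    proof (cases "\<exists>x. x \<notin> S \<and> poly f x = 0")
      case True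
      then obtain x where x: "x \<notin> S" "poly f x = 0" by blast
      then have "(\<Prod>x\<in>-S. 1 - ?v f {x}) = 0" by (intro prod_zero bexI[of _ x]) auto
      moreover have "{x. poly f x = 0} \<noteq> S" using x by blast
      ultimately show ?thesis by simp
    next
      case False
      then have "(\<Prod>x\<in>-S. 1 - ?v f {x}) = 1" by (intro prod.neutral) auto
      moreover have "{x. poly f x = 0} = S \<longleftrightarrow> (\<forall>x\<in>S. poly f x = 0)" using False by blast
      ultimately show ?thesis by simp
    qed
  qed
  also have "\<dots> = (\<Sum>f\<in>?D. \<Sum>T\<in>Pow (- S). (-1) ^ card T * ?v f (S \<union> T))"
  proof (intro sum.cong refl)
    fix f
    have "(\<Prod>x\<in>-S. 1 - ?v f {x}) = (\<Sum>T\<in>Pow (- S). (-1) ^ card T * ?v f T)"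
      by (subst prod_diff_conv_sum) (simp_all only: prod_v prod.neutral_const mult_1_right finite)
    then show "?v f S * (\<Prod>x\<in>-S. 1 - ?v f {x}) = (\<Sum>T\<in>Pow (- S). (-1) ^ card T * ?v f (S \<union> T))"
      by (simp only: sum_distrib_left) (intro sum.cong refl, simp add: ball_Un)
  qed
  also have "\<dots> = (\<Sum>T\<in>Pow (- S). \<Sum>f\<in>?D. (-1) ^ card T * ?v f (S \<union> T))"
    by (rule sum.swap)
  also have "\<dots> = (\<Sum>T\<in>Pow (- S). (-1) ^ card T *
      int (card {f :: 'a poly. f \<noteq> 0 \<and> degree f = d \<and> (\<forall>x\<in>S \<union> T. poly f x = 0)}))"
    unfolding count by (simp only: sum_distrib_left)
  finally show ?thesis .
qed

text \<open>Subsets are grouped by size \<open>k\<close>. The upper limit can be changed from q - i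
  to d - i because the binomial coefficient vanishes beyond the former and the conditional beyond
  the latter.\<close>

lemma sum_Pow_compl_truncated:
  fixes S :: "'a::finite set"
  assumes S: "card S = i" "i \<le> d"
  shows "(\<Sum>T\<in>Pow (- S). (-1) ^ card T * (if i + card T \<le> d then h (d - (i + card T)) else 0)) =
    (\<Sum>k=0..d-i. (-1) ^ k * int ((card (UNIV :: 'a set) - i) choose k) * h (d - i - k))"
proof -
  let ?q = "card (UNIV :: 'a set)"
  let ?g = "\<lambda>k. (-1) ^ k * (if i + k \<le> d then h (d - (i + k)) else 0)"
  have cardS: "card (- S) = ?q - i" using S by (simp add: Compl_eq_Diff_UNIV card_Diff_subset)
  have "(\<Sum>T\<in>Pow (- S). ?g (card T)) = (\<Sum>k\<le>?q - i. int ((?q - i) choose k) * ?g k)"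
    unfolding cardS[symmetric] by (rule sum_Pow_card) simp
  also have "\<dots> = (\<Sum>k\<in>{..?q - i} \<union> {0..d-i}. int ((?q - i) choose k) * ?g k)"
    by (rule sum.mono_neutral_left) auto
  also have "\<dots> = (\<Sum>k=0..d-i. int ((?q - i) choose k) * ?g k)"
    using S(2) by (intro sum.mono_neutral_right) auto
  also have "\<dots> = (\<Sum>k=0..d-i. (-1) ^ k * int ((?q - i) choose k) * h (d - i - k))"
    using S(2) by (intro sum.cong refl) (simp add: diff_diff_left)
  finally show ?thesis .
qed

text \<open>The polynomials are partitioned by their root set. The count depends only on the size of
  that set, so the number of \<open>i\<close>-element sets appears as a factor.\<close>

lemma card_poly_degree_num_roots:
  assumes "i \<le> d"
  shows "int (card {f :: 'a::{field,finite} poly. f \<noteq> 0 \<and> degree f = d \<and> num_roots f = i}) =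
    (int (card (UNIV :: 'a set)) - 1) * int (card (UNIV :: 'a set) choose i) *
      (\<Sum>k=0..d-i. (-1) ^ k * int ((card (UNIV :: 'a set) - i) choose k) *
        int (card (UNIV :: 'a set)) ^ (d - i - k))"
proof -
  let ?q = "card (UNIV :: 'a set)"
  let ?R = "\<lambda>S. {f :: 'a poly. f \<noteq> 0 \<and> degree f = d \<and> {x. poly f x = 0} = S}"
  have q: "?q \<ge> 1" by (simp add: Suc_leI card_gt_0_iff)
  have finR: "finite (?R S)" for S
    by (rule finite_subset[OF _ conjunct2[OF card_nonzero_poly_degree[of d]]]) auto
  have card_R: "int (card (?R S)) = (int ?q - 1) * (\<Sum>k=0..d-i. (-1) ^ k * int ((?q - i) choose k) *
      int ?q ^ (d - i - k))" if S: "card S = i" for S :: "'a set"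
  proof -
    have "int (card (?R S)) = (\<Sum>T\<in>Pow (- S). (-1) ^ card T *
        (if i + card T \<le> d then (int ?q - 1) * int ?q ^ (d - (i + card T)) else 0))"
      unfolding card_poly_root_set
    proof (intro sum.cong refl)
      fix T assume "T \<in> Pow (- S)"
      then have "card (S \<union> T) = i + card T"
        using S by (subst card_Un_disjoint) auto
      then show "(-1) ^ card T * int (card {f :: 'a poly. f \<noteq> 0 \<and> degree f = d \<and> (\<forall>x\<in>S \<union> T. poly f x = 0)}) =
          (-1) ^ card T * (if i + card T \<le> d then (int ?q - 1) * int ?q ^ (d - (i + card T)) else 0)"
        using q by (simp only: card_poly_vanishing) (simp add: of_nat_diff)
    qed
    also have "\<dots> = (\<Sum>k=0..d-i. (-1) ^ k * int ((?q - i) choose k) * ((int ?q - 1) * int ?q ^ (d - i - k)))"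
      by (rule sum_Pow_compl_truncated[OF S assms, of "\<lambda>e. (int ?q - 1) * int ?q ^ e"])
    also have "\<dots> = (int ?q - 1) * (\<Sum>k=0..d-i. (-1) ^ k * int ((?q - i) choose k) * int ?q ^ (d - i - k))"
      unfolding sum_distrib_left by (intro sum.cong refl) (simp only: mult_ac)
    finally show ?thesis .
  qed
  have "{f :: 'a poly. f \<noteq> 0 \<and> degree f = d \<and> num_roots f = i} = (\<Union>S\<in>{S. card S = i}. ?R S)"
    by (auto simp: num_roots_def)
  then have "card {f :: 'a poly. f \<noteq> 0 \<and> degree f = d \<and> num_roots f = i} =
      (\<Sum>S\<in>{S. card S = i}. card (?R S))"
    by (simp only:) (rule card_UN_disjoint, simp, use finR in blast, blast)
  then have "int (card {f :: 'a poly. f \<noteq> 0 \<and> degree f = d \<and> num_roots f = i}) =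
      (\<Sum>S\<in>{S :: 'a set. card S = i}. int (card (?R S)))"
    by (simp only: of_nat_sum)
  also have "\<dots> = (\<Sum>S\<in>{S :: 'a set. card S = i}.
      (int ?q - 1) * (\<Sum>k=0..d-i. (-1) ^ k * int ((?q - i) choose k) * int ?q ^ (d - i - k)))"
    by (rule sum.cong[OF refl]) (rule card_R, simp)
  also have "\<dots> = (int ?q - 1) * int (?q choose i) *
      (\<Sum>k=0..d-i. (-1) ^ k * int ((?q - i) choose k) * int ?q ^ (d - i - k))"
    using n_subsets[of "UNIV :: 'a set" i] by simp
  finally show ?thesis .
qed

lemma num_roots_le_degree:
  assumes "f \<noteq> 0"
  shows "num_roots f \<le> degree f"
  unfolding num_roots_def by (rule card_poly_roots_bound[OF assms])

lemma num_roots_zero: "num_roots (0 :: 'a::field poly) = card (UNIV :: 'a set)"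
  by (simp add: num_roots_def)

text \<open>Since \<open>i\<close> is less than q, the zero polynomial is excluded. A nonzero
  polynomial with \<open>i\<close> roots has degree at least \<open>i\<close>, so a partition by
  degree starts at \<open>i\<close>.\<close>

lemma card_poly_degree_le_num_roots:
  assumes "i < card (UNIV :: 'a set)"
  shows "int (card {f :: 'a::{field,finite} poly. degree f \<le> n \<and> num_roots f = i}) =
    (int (card (UNIV :: 'a set)) - 1) * int (card (UNIV :: 'a set) choose i) *
      (\<Sum>d=i..n. \<Sum>k=0..d-i. (-1) ^ k * int ((card (UNIV :: 'a set) - i) choose k) *
        int (card (UNIV :: 'a set)) ^ (d - i - k))"
proof -
  let ?D = "\<lambda>d. {f :: 'a poly. f \<noteq> 0 \<and> degree f = d \<and> num_roots f = i}"
  have nz: "f \<noteq> 0" if "num_roots f = i" for f :: "'a poly"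
    using that assms num_roots_zero[where 'a = 'a] by auto
  have "{f :: 'a poly. degree f \<le> n \<and> num_roots f = i} = (\<Union>d\<in>{i..n}. ?D d)"
    using nz num_roots_le_degree by fastforce
  moreover have "card (\<Union>d\<in>{i..n}. ?D d) = (\<Sum>d=i..n. card (?D d))"
  proof (rule card_UN_disjoint)
    have "finite (?D d)" for d
      by (rule finite_subset[OF _ conjunct2[OF card_nonzero_poly_degree[of d]]]) auto
    then show "\<forall>d\<in>{i..n}. finite (?D d)" by blast
  qed auto
  ultimately have "int (card {f :: 'a poly. degree f \<le> n \<and> num_roots f = i}) = (\<Sum>d=i..n. int (card (?D d)))"
    by simp
  also have "\<dots> = (\<Sum>d=i..n. (int (card (UNIV :: 'a set)) - 1) * int (card (UNIV :: 'a set) choose i) *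
      (\<Sum>k=0..d-i. (-1) ^ k * int ((card (UNIV :: 'a set) - i) choose k) *
        int (card (UNIV :: 'a set)) ^ (d - i - k)))"
    by (rule sum.cong[OF refl]) (rule card_poly_degree_num_roots, simp)
  finally show ?thesis by (simp only: sum_distrib_left)
qed

section \<open>From coefficient vectors to polynomials\<close>

lemma num_roots_smult: "a \<noteq> 0 \<Longrightarrow> num_roots (Polynomial.smult a f) = num_roots f"
  by (simp add: num_roots_def)

lemma jw_poly_split:
  fixes c :: "nat \<Rightarrow> 'a::field"
  assumes "m \<ge> 1"
  shows "jw_poly m c = (\<Sum>j\<le>m-1. monom (c (Suc j)) j) + monom (c (m + 1)) (m + 2)"
proof -
  have "{1..m+1} = insert (m + 1) {1..m}" by auto
  then have "jw_poly m c = monom (c (m + 1)) (m + 2) + (\<Sum>k\<in>{1..m}. monom (c k) (jw_exponent m k))"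
    unfolding jw_poly_def by (simp add: jw_exponent_def)
  also have "(\<Sum>k\<in>{1..m}. monom (c k) (jw_exponent m k)) = (\<Sum>j\<le>m-1. monom (c (Suc j)) j)"
    by (rule sum.reindex_bij_witness[of _ Suc "\<lambda>k. k - 1"]) (use assms in \<open>auto simp: jw_exponent_def\<close>)
  finally show ?thesis by (simp only: add.commute)
qed

text \<open>A vector corresponds bijectively to the pair of its last coordinate, which is the
  coefficient of degree \<open>m + 2\<close>, and the polynomial of degree at most
  \<open>m - 1\<close> formed by the others.\<close>

lemma card_jw_poly:
  fixes Q :: "'a::{field,finite} poly \<Rightarrow> bool"
  assumes m: "m \<ge> 1"
  shows "card {c \<in> jw_vectors m. Q (jw_poly m c)} =
    (\<Sum>a\<in>UNIV. card {v. degree v \<le> m - 1 \<and> Q (v + monom a (m + 2))})"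
proof -
  let ?low = "\<lambda>c :: nat \<Rightarrow> 'a. \<Sum>j\<le>m-1. monom (c (Suc j)) j"
  let ?B = "Sigma UNIV (\<lambda>a. {v. degree v \<le> m - 1 \<and> Q (v + monom a (m + 2))})"
  let ?to = "\<lambda>c. (c (m + 1), ?low c)"
  \<comment> \<open>Coordinate \<open>k\<close> holds the coefficient of degree
    \<open>k - 1\<close>, except for the last one; the restriction makes the function
    extensional.\<close>
  let ?from = "\<lambda>(a, v). (\<lambda>k\<in>{1..m+1}. if k = m + 1 then a else coeff v (k - 1))"
  have low_deg: "degree (?low c) \<le> m - 1" for c
    by (intro degree_sum_le) (auto intro: order_trans[OF degree_monom_le])
  have low_coeff: "coeff (?low c) j = c (Suc j)" if "j \<le> m - 1" for c j
    using that by (simp add: coeff_sum)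
  have "bij_betw ?to {c \<in> jw_vectors m. Q (jw_poly m c)} ?B"
  proof (rule bij_betw_byWitness[where f' = ?from])
    show "\<forall>c\<in>{c \<in> jw_vectors m. Q (jw_poly m c)}. ?from (?to c) = c"
    proof (intro ballI ext)
      fix c k assume c: "c \<in> {c \<in> jw_vectors m. Q (jw_poly m c)}"
      consider "k \<notin> {1..m+1}" | "k = m + 1" | "k \<in> {1..m}" by fastforce
      then show "?from (?to c) k = c k"
      proof cases
        case 1 then show ?thesis using c by (auto simp: PiE_def extensional_def)
      next
        case 2 then show ?thesis by simp
      next
        case 3
        then have "k - 1 \<le> m - 1" "Suc (k - 1) = k" "k \<noteq> m + 1" "k \<in> {1..m+1}" by auto
        then show ?thesis using low_coeff[of "k - 1" c] by simp
      qed
    qed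
    show "\<forall>b\<in>?B. ?to (?from b) = b"
    proof
      fix b assume "b \<in> ?B"
      then obtain a v where b: "b = (a, v)" "degree v \<le> m - 1" by auto
      have "?low (?from b) = (\<Sum>j\<le>m-1. monom (coeff v j) j)"
        using m b(1) by (intro sum.cong refl) auto
      also have "\<dots> = v" by (rule poly_as_sum_of_monoms'[OF b(2)])
      finally show "?to (?from b) = b" using b(1) by simp
    qed
    show "?to ` {c \<in> jw_vectors m. Q (jw_poly m c)} \<subseteq> ?B"
    proof (rule image_subsetI)
      fix c assume "c \<in> {c \<in> jw_vectors m. Q (jw_poly m c)}"
      then have "Q (jw_poly m c)" by simp
      then have "Q (?low c + monom (c (m + 1)) (m + 2))"
        by (simp only: jw_poly_split[OF m])
      then show "?to c \<in> ?B"
        by (intro SigmaI UNIV_I CollectI conjI low_deg)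
    qed
    show "?from ` ?B \<subseteq> {c \<in> jw_vectors m. Q (jw_poly m c)}"
    proof
      fix c assume "c \<in> ?from ` ?B"
      then obtain a v where c: "c = ?from (a, v)" and v: "degree v \<le> m - 1" "Q (v + monom a (m + 2))"
        by auto
      have "?low c = (\<Sum>j\<le>m-1. monom (coeff v j) j)"
        using m c by (intro sum.cong refl) auto
      also have "\<dots> = v" by (rule poly_as_sum_of_monoms'[OF v(1)])
      finally have "jw_poly m c = v + monom a (m + 2)"
        unfolding jw_poly_split[OF m] using c by simp
      moreover have "c \<in> jw_vectors m" using c by simp
      ultimately show "c \<in> {c \<in> jw_vectors m. Q (jw_poly m c)}" using v(2) by simp
    qed
  qed
  then have "card {c \<in> jw_vectors m. Q (jw_poly m c)} = card ?B"
    by (rule bij_betw_same_card)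
  also have "\<dots> = (\<Sum>a\<in>UNIV. card {v. degree v \<le> m - 1 \<and> Q (v + monom a (m + 2))})"
  proof (rule card_SigmaI)
    show "\<forall>a\<in>UNIV. finite {v. degree v \<le> m - 1 \<and> Q (v + monom a (m + 2))}"
      by (intro ballI finite_subset[OF _ finite_poly_degree_le[of "m - 1"]]) auto
  qed simp
  finally show ?thesis .
qed

text \<open>Dividing by \<open>a\<close> makes the polynomial monic in degree \<open>k\<close>
  without changing its roots or the degree bound on the lower part.\<close>

lemma card_monic_scaled:
  fixes a :: "'a::{field,finite}"
  assumes "a \<noteq> 0"
  shows "card {v. degree v \<le> n \<and> num_roots (v + monom a k) = i} = num_root_polys i (monom (1 :: 'a) k) n"
  unfolding num_root_polys_def num_roots_def[symmetric]
proof (rule bij_betw_same_card)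
  let ?A = "{v. degree v \<le> n \<and> num_roots (v + monom a k) = i}"
    and ?B = "{v :: 'a poly. degree v \<le> n \<and> num_roots (monom 1 k + v) = i}"
  have scale: "v + monom a k = Polynomial.smult a (monom 1 k + Polynomial.smult (inverse a) v)" for v
    using assms by (simp add: smult_add_right smult_monom)
  have unscale: "monom 1 k + v = Polynomial.smult (inverse a) (Polynomial.smult a v + monom a k)" for v
    using assms by (simp add: smult_add_right smult_monom)
  show "bij_betw (Polynomial.smult (inverse a)) ?A ?B"
  proof (rule bij_betw_byWitness[where f' = "Polynomial.smult a"])
    show "Polynomial.smult (inverse a) ` ?A \<subseteq> ?B"
      using assms num_roots_smult[OF assms] unfolding scale by auto
    show "Polynomial.smult a ` ?B \<subseteq> ?A"
      using assms unfolding unscale by (auto simp: num_roots_smult)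
  qed (use assms in simp_all)
qed

text \<open>The first summand comes from leading coefficient 0; each of the q - 1 nonzero leading
  coefficients contributes \<open>N\<^sub>i\<close> after scaling.\<close>

lemma card_jw_poly_num_roots:
  assumes m: "m \<ge> 1"
  shows "card {c \<in> jw_vectors m. num_roots (jw_poly m (c :: nat \<Rightarrow> 'a::{field,finite})) = i} =
    card {v :: 'a poly. degree v \<le> m - 1 \<and> num_roots v = i} +
    (card (UNIV :: 'a set) - 1) * num_root_polys i (monom (1 :: 'a) (m + 2)) (m - 1)"
proof -
  have "card {c \<in> jw_vectors m. num_roots (jw_poly m (c :: nat \<Rightarrow> 'a)) = i} =
      (\<Sum>a\<in>UNIV. card {v :: 'a poly. degree v \<le> m - 1 \<and> num_roots (v + monom a (m + 2)) = i})"
    by (rule card_jw_poly[OF m])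
  also have "\<dots> = card {v :: 'a poly. degree v \<le> m - 1 \<and> num_roots (v + monom 0 (m + 2)) = i} +
      (\<Sum>a\<in>UNIV - {0}. card {v :: 'a poly. degree v \<le> m - 1 \<and> num_roots (v + monom a (m + 2)) = i})"
    by (rule sum.remove) simp_all
  also have "(\<Sum>a\<in>UNIV - {0}. card {v :: 'a poly. degree v \<le> m - 1 \<and> num_roots (v + monom a (m + 2)) = i}) =
      (\<Sum>a\<in>UNIV - {0 :: 'a}. num_root_polys i (monom (1 :: 'a) (m + 2)) (m - 1))"
    by (rule sum.cong[OF refl]) (rule card_monic_scaled, simp)
  finally show ?thesis by (simp add: card_Diff_subset)
qed

section \<open>Spectrum\<close>

lemma square_eq_times_num_roots_iff:
  assumes "r\<^sup>2 = real i * real (card (UNIV :: 'a::{field,finite} set))"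
  shows "r\<^sup>2 = gram_eigenvalue m (c :: nat \<Rightarrow> 'a) \<longleftrightarrow> num_roots (jw_poly m c) = i"
proof -
  have "card (UNIV :: 'a set) > 0" by (simp add: card_gt_0_iff)
  then show ?thesis
    unfolding assms gram_eigenvalue_def by (auto simp flip: of_nat_mult)
qed

lemma order_char_poly_jw_sqrt:
  fixes vs :: "((nat \<Rightarrow> 'a::{field,finite}) + (nat \<Rightarrow> 'a)) list"
  assumes "m \<ge> 1" "distinct vs" "set vs = jw_vertices m"
    and r: "r\<^sup>2 = real i * real (card (UNIV :: 'a set))"
  shows "order r (char_poly (adjacency_matrix (jw_adj m) vs)) =
    (if i = 0 then 2 else 1) * card {c \<in> jw_vectors m. num_roots (jw_poly m (c :: nat \<Rightarrow> 'a)) = i}"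
proof -
  have "r = 0 \<longleftrightarrow> r\<^sup>2 = 0" by simp
  also have "\<dots> \<longleftrightarrow> i = 0" unfolding r by (simp add: card_gt_0_iff)
  finally show ?thesis
    by (simp only: order_char_poly_jw[OF assms(1-3)] square_eq_times_num_roots_iff[OF r])
qed

lemma eigenvalue_jw_sqrt_iff:
  fixes vs :: "((nat \<Rightarrow> 'a::{field,finite}) + (nat \<Rightarrow> 'a)) list"
  assumes "m \<ge> 1" "distinct vs" "set vs = jw_vertices m"
    and r: "r\<^sup>2 = real i * real (card (UNIV :: 'a set))"
  shows "eigenvalue (adjacency_matrix (jw_adj m) vs) r \<longleftrightarrow>
    card {c \<in> jw_vectors m. num_roots (jw_poly m (c :: nat \<Rightarrow> 'a)) = i} > 0"
proof -
  have "finite {c \<in> jw_vectors m. num_roots (jw_poly m (c :: nat \<Rightarrow> 'a)) = i}"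
    by (rule finite_subset[of _ "jw_vectors m"]) (auto intro: finite_PiE)
  then show ?thesis
    by (simp only: eigenvalue_jw_iff[OF assms(1-3)] square_eq_times_num_roots_iff[OF r]
        card_gt_0_iff) blast
qed

text \<open>The witness is the product of the X - x over an \<open>i\<close>-element set. It shows
  that the square roots of iq occur as eigenvalues for every \<open>i\<close> below
  \<open>m\<close>, whatever the value of \<open>N\<^sub>i\<close>.\<close>

lemma card_split_polys_pos:
  assumes "i \<le> n" "i \<le> card (UNIV :: 'a set)"
  shows "card {v :: 'a::{field,finite} poly. degree v \<le> n \<and> num_roots v = i} > 0"
proof -
  obtain S :: "'a set" where S: "card S = i"
    using obtain_subset_with_card_n[OF assms(2)] by metis
  let ?v = "\<Prod>x\<in>S. [:- x, 1:]"
  have "degree ?v = i" using S by (subst degree_prod_sum_eq) auto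
  moreover have "{x. poly ?v x = 0} = S" by (auto simp: poly_prod)
  then have "num_roots ?v = i" using S by (simp only: num_roots_def)
  ultimately have "?v \<in> {v. degree v \<le> n \<and> num_roots v = i}" using assms(1) by simp
  moreover have "finite {v :: 'a poly. degree v \<le> n \<and> num_roots v = i}"
    by (rule finite_subset[OF _ finite_poly_degree_le[of n]]) auto
  ultimately show ?thesis unfolding card_gt_0_iff by blast
qed

text \<open>The zero vector gives the zero polynomial, at which every field element vanishes; this
  accounts for the eigenvalues q and -q.\<close>

lemma card_jw_poly_zero_pos:
  "card {c \<in> jw_vectors m. num_roots (jw_poly m (c :: nat \<Rightarrow> 'a::{field,finite})) = card (UNIV :: 'a set)} > 0"
proof -
  let ?c = "\<lambda>k\<in>{1..m+1}. 0 :: 'a"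
  have "jw_poly m ?c = 0" by (simp add: jw_poly_def)
  then have "num_roots (jw_poly m ?c) = card (UNIV :: 'a set)" by (simp only: num_roots_zero)
  moreover have "?c \<in> jw_vectors m" by (rule restrict_PiE_iff[THEN iffD2]) simp
  ultimately have "?c \<in> {c \<in> jw_vectors m. num_roots (jw_poly m c) = card (UNIV :: 'a set)}" by simp
  moreover have "finite {c \<in> jw_vectors m. num_roots (jw_poly m (c :: nat \<Rightarrow> 'a)) = card (UNIV :: 'a set)}"
    by (rule finite_subset[of _ "jw_vectors m"]) (auto intro: finite_PiE)
  ultimately show ?thesis unfolding card_gt_0_iff by blast
qed

text \<open>For \<open>i\<close> below \<open>n\<close> the square root of iq lies strictly between
  0 and q and is injective in \<open>i\<close>, so signs and sizes separate all the listed
  values.\<close>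

lemma distinct_jw_eigenvalues:
  assumes "n < q"
  shows "distinct ([real q, - real q] @ map (\<lambda>i. sqrt (real i * real q)) [1..<n] @
    map (\<lambda>i. - sqrt (real i * real q)) [1..<n] @ [0])"
proof -
  let ?s = "\<lambda>i. sqrt (real i * real q)"
  have q: "q > 0" using assms by simp
  have pos: "?s i > 0" if "i \<in> {1..<n}" for i using that q by simp
  have less: "?s i < real q" if "i \<in> {1..<n}" for i
  proof -
    have "real i * real q < real q * real q" using that q assms by simp
    then have "?s i < sqrt (real q * real q)" by (rule real_sqrt_less_mono)
    then show ?thesis by simp
  qed
  have inj: "inj_on ?s {1..<n}" using q by (intro inj_onI) simp
  then have "inj_on (\<lambda>i. - ?s i) {1..<n}" by (simp add: inj_on_def)
  moreover have neq: "real q \<noteq> ?s i" "real q \<noteq> - ?s i" "- real q \<noteq> ?s i" "- real q \<noteq> - ?s i"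
    "0 \<noteq> ?s i" "0 \<noteq> - ?s i" if "i \<in> {1..<n}" for i
    using pos[OF that] less[OF that] q by linarith+
  have "real q \<notin> ?s ` {1..<n}" "real q \<notin> (\<lambda>i. - ?s i) ` {1..<n}"
    "- real q \<notin> ?s ` {1..<n}" "- real q \<notin> (\<lambda>i. - ?s i) ` {1..<n}"
    "0 \<notin> ?s ` {1..<n}" "0 \<notin> (\<lambda>i. - ?s i) ` {1..<n}"
    using neq by blast+
  moreover have "?s i \<noteq> - ?s j" if "i \<in> {1..<n}" "j \<in> {1..<n}" for i j
    using pos[OF that(1)] pos[OF that(2)] by linarith
  then have "?s ` {1..<n} \<inter> (\<lambda>i. - ?s i) ` {1..<n} = {}" by blast
  ultimately show ?thesis
    using inj q by (simp add: distinct_map)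
qed

theorem theorem5p2:
  fixes p e q m :: nat
    and vs :: "((nat \<Rightarrow> 'a::{field,finite}) + (nat \<Rightarrow> 'a)) list"
    and A :: "real mat"
    and N :: "nat \<Rightarrow> nat"
  assumes "prime p" and "odd p" and "e \<ge> 1" and "q = p ^ (2 * e)"
    and "card (UNIV :: 'a set) = q"
    and "m \<ge> 1" and "m + 2 \<le> q - 1"
    and "distinct vs" and "set vs = jw_vertices m"
    and "A = adjacency_matrix (jw_adj m) vs"
    and "\<forall>i. N i = num_root_polys i (monom (1::'a) (m + 2)) (m - 1)"
  shows
    "(let evs = [real q, - real q]
                  @ map (\<lambda>i. sqrt (real i * real q)) [1..<m]
                  @ map (\<lambda>i. - sqrt (real i * real q)) [1..<m] @ [0]
      in distinct evs \<and> (\<forall>r\<in>set evs. eigenvalue A r))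
     \<and>
     (\<forall>i\<in>{0..m-1}. \<forall>r\<in>{sqrt (real i * real q), - sqrt (real i * real q)}.
        int (order r (char_poly A)) =
          (if i = 0 then 2 else 1) *
          ((int q - 1) * int (q choose i) *
             (\<Sum>d=i..m-1. \<Sum>k=0..d-i. (-1) ^ k * int ((q - i) choose k) * int q ^ (d - i - k))
           + (int q - 1) * int (N i)))
     \<and>
     (\<forall>i\<in>{m..m+2}. \<forall>r\<in>{sqrt (real i * real q), - sqrt (real i * real q)}.
        (eigenvalue A r \<longleftrightarrow> N i > 0) \<and>
        int (order r (char_poly A)) = (int q - 1) * int (N i))"
proof -
  let ?V = "\<lambda>i. {c \<in> jw_vectors m. num_roots (jw_poly m (c :: nat \<Rightarrow> 'a)) = i}"
  let ?W = "\<lambda>i. {v :: 'a poly. degree v \<le> m - 1 \<and> num_roots v = i}"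
  have q: "card (UNIV :: 'a set) = q" and mq: "m + 2 < q" using assms(5,6,7) by auto
  have N: "num_root_polys i (monom (1::'a) (m + 2)) (m - 1) = N i" for i
    using assms(11) by simp
  have order: "order r (char_poly A) = (if i = 0 then 2 else 1) * card (?V i)"
    if "r\<^sup>2 = real i * real q" for r i
    unfolding assms(10) by (rule order_char_poly_jw_sqrt[OF assms(6,8,9)]) (simp only: that q)
  have ev: "eigenvalue A r \<longleftrightarrow> card (?V i) > 0" if "r\<^sup>2 = real i * real q" for r i
    unfolding assms(10) by (rule eigenvalue_jw_sqrt_iff[OF assms(6,8,9)]) (simp only: that q)
  have V: "card (?V i) = card (?W i) + (q - 1) * N i" for i
    using card_jw_poly_num_roots[OF assms(6), where 'a = 'a] unfolding q N .
  have W: "int (card (?W i)) = (int q - 1) * int (q choose i) *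
      (\<Sum>d=i..m-1. \<Sum>k=0..d-i. (-1) ^ k * int ((q - i) choose k) * int q ^ (d - i - k))"
    if "i < q" for i
    using card_poly_degree_le_num_roots[where 'a = 'a, of i "m - 1"] that unfolding q by blast
  have int_V: "int (card (?V i)) = int (card (?W i)) + (int q - 1) * int (N i)" for i
    unfolding V using mq by (simp add: of_nat_diff)
  have sq: "r\<^sup>2 = real i * real q" if "r \<in> {sqrt (real i * real q), - sqrt (real i * real q)}" for r i
    using that by auto
  have ev_low: "eigenvalue A r" if "i < m" "r\<^sup>2 = real i * real q" for r i
    unfolding ev[OF that(2)] V
    using card_split_polys_pos[where 'a = 'a, of i "m - 1"] that(1) mq q by simp
  \<comment> \<open>This is the instance \<open>i = q\<close> of \<open>ev\<close>, since q squared
    is q times q.\<close>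
  have ev_q: "eigenvalue A r" if "r\<^sup>2 = real q * real q" for r
    unfolding ev[OF that] using card_jw_poly_zero_pos[where 'a = 'a, of m] unfolding q .
  have low: "int (order r (char_poly A)) = (if i = 0 then 2 else 1) *
      ((int q - 1) * int (q choose i) *
         (\<Sum>d=i..m-1. \<Sum>k=0..d-i. (-1) ^ k * int ((q - i) choose k) * int q ^ (d - i - k))
       + (int q - 1) * int (N i))"
    if i: "i \<in> {0..m-1}" and r: "r \<in> {sqrt (real i * real q), - sqrt (real i * real q)}" for i r
  proof -
    have "i < q" using i mq by simp
    then show ?thesis unfolding order[OF sq[OF r]] W[symmetric, OF \<open>i < q\<close>] int_V[symmetric] by simp
  qed
  \<comment> \<open>For \<open>i \<ge> m\<close> the degree range from \<open>i\<close> to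
    \<open>m - 1\<close> is empty (positivity of \<open>m\<close> matters for the natural
    subtraction), so only the vectors with nonzero last coordinate remain.\<close>
  have high: "card (?V i) = (q - 1) * N i" if "i \<in> {m..m+2}" for i
  proof -
    have "i < q" "{i..m-1} = {}" using that mq assms(6) by auto
    then have "int (card (?W i)) = 0" using W[of i] by (simp only: sum.empty mult_zero_right)
    then have "card (?W i) = 0" by simp
    then show ?thesis unfolding V by simp
  qed
  have "(eigenvalue A r \<longleftrightarrow> N i > 0) \<and> int (order r (char_poly A)) = (int q - 1) * int (N i)"
    if i: "i \<in> {m..m+2}" and r: "r \<in> {sqrt (real i * real q), - sqrt (real i * real q)}" for i r
  proof
    show "eigenvalue A r \<longleftrightarrow> N i > 0"
      unfolding ev[OF sq[OF r]] high[OF i] using mq by simp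
    have "i \<noteq> 0" using i assms(6) by simp
    then show "int (order r (char_poly A)) = (int q - 1) * int (N i)"
      unfolding order[OF sq[OF r]] high[OF i] using mq by (simp add: of_nat_diff)
  qed
  moreover have "eigenvalue A r"
    if r: "r \<in> set ([real q, - real q] @ map (\<lambda>i. sqrt (real i * real q)) [1..<m] @
      map (\<lambda>i. - sqrt (real i * real q)) [1..<m] @ [0])" for r
  proof -
    consider "r = real q \<or> r = - real q" | "r = 0"
      | i where "i < m" "r = sqrt (real i * real q) \<or> r = - sqrt (real i * real q)"
      using r by auto
    then show ?thesis
    proof cases
      case 1 then show ?thesis by (intro ev_q) (auto simp: power2_eq_square)
    next
      \<comment> \<open>The eigenvalue 0 is the case \<open>i = 0\<close>, which lies below
        \<open>m\<close> because \<open>m\<close> is positive.\<close>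
      case 2 then show ?thesis using assms(6) by (intro ev_low[of 0]) auto
    next
      case 3 then show ?thesis by (intro ev_low[of i] sq) auto
    qed
  qed
  moreover have "m < q" using mq by simp
  ultimately show ?thesis
    unfolding Let_def by (intro conjI ballI low distinct_jw_eigenvalues) blast+
qed

end
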